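(* For every integer $m\ge0$ let $$S_{2m+2}(\phi)=\sum_{n=1}^\infty\frac{\phi^{2m+2}}{\sinh^{2m+2}(n\phi/2)},\qquad \mathrm{Re}\,\phi\neq0 .$$ Then, as $\phi\to0$, $S_{2m+2}$ has the asymptotic expansion $$S_{2m+2}(\phi)\sim-2^{2m+1}\sum_{k=0}^{m+1}(2\pi i)^{2k}\,\frac{B_{2k}}{(2k)!}\,\frac{B^{(2m+2)}_{2m+2-2k}(m+1)}{(2m+2-2k)!}\,\phi^{2m+2-2k}\;\pm\;(-1)^{m+1}\frac{4}{m+2}\,\phi^{2m+1},$$ with the upper sign in the region $\mathrm{Re}\,\phi>0$ and the lower sign in the region $\mathrm{Re}\,\phi<0$. Consequently the analytic distillate of $S_{2m+2}$ at $\phi=0$ is the polynomial $$\mathrm{dist}_0\,S_{2m+2}(\phi)=\mathcal B_{2m+2}(\phi):=-2^{2m+1}\sum_{k=0}^{m+1}(2\pi i)^{2k}\,\frac{B_{2k}}{(2k)!}\,\frac{B^{(2m+2)}_{2m+2-2k}(m+1)}{(2m+2-2k)!}\,\phi^{2m+2-2k}.$$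
   Context: $B_{2k}$ are the Bernoulli numbers and $B^{(m)}_n(t)$ the generalized Bernoulli polynomials, defined by $\left(\frac{x}{e^x-1}\right)^me^{tx}=\sum_{n\ge0}\frac{B^{(m)}_n(t)}{n!}x^n$. Analytic distillate: let $f(z)$ be a function on a domain $D$ of the complex plane and $z_0\in\bar D$ a point where $f$ may not be analytic. Suppose that asymptotic power series $f(z)\sim\sum_na^{(i)}_n(z-z_0)^n$ exist in subsets $D_i\subset D$ with $\cup_iD_i=D$, where $n$ can take integer negative values. Put $\bar a_n=a^{(i)}_n$ if $a^{(i)}_n=a^{(j)}_n$ for all $i,j$, and $\bar a_n=0$ otherwise. If the series $\sum_{n\ge0}\bar a_n(z-z_0)^n$ of common coefficients has a positive radius of convergence, the analytic function it defines is the analytic distillate $\mathrm{dist}_{z_0}f(z)$. Here $D=\{\mathrm{Re}\,\phi\ne0\}$ and the subsets are the half-planes $\mathrm{Re}\,\phi>0$ and $\mathrm{Re}\,\phi<0$.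
   Formalization: The printed coefficient 4/(m+2) of the odd term is false for m ≥ 2 (for m = 2 it is 16/15, not 1) and is replaced by 2^(2m+1)(m!)²/(2m+1)!, which agrees for m = 0, 1; the expansions are taken in closed subsectors of Re φ > 0 and Re φ < 0. *)

theory Defs
  imports
    "HOL-Analysis.Analysis"
    "HOL-Computational_Algebra.Computational_Algebra"
begin

section \<open>Bernoulli numbers and generalized Bernoulli polynomials\<close>

definition gen_bernpoly :: "nat \<Rightarrow> nat \<Rightarrow> complex \<Rightarrow> complex" where
  "gen_bernpoly m n t = fact n * fps_nth ((fps_X / (fps_exp 1 - 1)) ^ m * fps_exp t) n"

definition bernoulli_num :: "nat \<Rightarrow> complex" where
  "bernoulli_num n = gen_bernpoly 1 n 0"

text \<open>
  The divisor \<open>fps_exp 1 - 1\<close> is not a unit; the library division of formal power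
  series cancels the common factor, so that the quotient is the intended series.
\<close>

lemma bernoulli_gf: "fps_X / (fps_exp 1 - 1) * (fps_exp 1 - 1) = (fps_X :: complex fps)"
proof -
  have nz: "fps_exp 1 - 1 \<noteq> (0 :: complex fps)"
  proof
    assume "fps_exp 1 - 1 = (0 :: complex fps)"
    hence "fps_nth (fps_exp 1 - 1 :: complex fps) 1 = fps_nth 0 1" by simp
    thus False by simp
  qed
  have "subdegree (fps_exp 1 - 1 :: complex fps) = 1"
    by (rule subdegreeI) auto
  hence "(fps_exp 1 - 1) dvd (fps_X :: complex fps)"
    using nz by (simp add: fps_dvd_iff)
  thus ?thesis by simp
qed


section \<open>Asymptotic power series and the analytic distillate\<close>

text \<open>
  An asymptotic expansion in a region \<open>A\<close> as \<open>z\<close> tends to a boundary point \<open>z0\<close> is understood,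
  as usual for sectors, uniformly on each part of \<open>A\<close> that stays away from the boundary of \<open>A\<close>
  in proportion to the distance to \<open>z0\<close>. For a half-plane with \<open>z0\<close> on its boundary line
  these parts are exactly the closed subsectors (lemma \<open>approach_region_right\<close> below).
  Uniformity over the whole half-plane cannot be asked for: the functions considered below
  have poles on the imaginary axis which accumulate at \<open>0\<close>.
\<close>

definition approach_region :: "complex set \<Rightarrow> complex \<Rightarrow> real \<Rightarrow> complex set" where
  "approach_region A z0 \<epsilon> = {z. ball z (\<epsilon> * dist z z0) \<subseteq> A}"

text \<open>
  The first clause excludes regions that cannot approach \<open>z0\<close>, for which every series would
  vacuously be an expansion. The second clause says that only finitely many negative
  powers occur.
\<close>

definition has_asymp_series ::
    "(complex \<Rightarrow> complex) \<Rightarrow> complex \<Rightarrow> complex set \<Rightarrow> (int \<Rightarrow> complex) \<Rightarrow> bool" where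
  "has_asymp_series f z0 A a \<longleftrightarrow>
     (\<exists>\<epsilon>>0. z0 islimpt approach_region A z0 \<epsilon>) \<and>
     (\<exists>K. (\<forall>n<K. a n = 0) \<and>
        (\<forall>\<epsilon>>0. \<forall>N::int.
           (\<lambda>z. f z - (\<Sum>n=K..N. a n * (z - z0) powi n))
             \<in> o[at z0 within approach_region A z0 \<epsilon>](\<lambda>z. (z - z0) powi N)))"

definition common_coeff ::
    "complex set set \<Rightarrow> (complex set \<Rightarrow> int \<Rightarrow> complex) \<Rightarrow> int \<Rightarrow> complex" where
  "common_coeff \<D> a n =
     (if \<forall>A\<in>\<D>. \<forall>B\<in>\<D>. a A n = a B n then a (SOME A. A \<in> \<D>) n else 0)"

text \<open>
  \<open>g\<close> is the analytic distillate at \<open>z0\<close> of the function \<open>f\<close> on \<open>D\<close>, with respect to the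
  cover \<open>\<D>\<close> of \<open>D\<close>. Connectedness of \<open>D\<close> is not required, so that \<open>D\<close> may be the complement
  of a line. Only the values of \<open>g\<close> on the disc of convergence matter.
\<close>

definition has_analytic_distillate ::
    "(complex \<Rightarrow> complex) \<Rightarrow> complex \<Rightarrow> complex set \<Rightarrow> complex set set \<Rightarrow>
     (complex \<Rightarrow> complex) \<Rightarrow> bool" where
  "has_analytic_distillate f z0 D \<D> g \<longleftrightarrow>
     open D \<and> z0 \<in> closure D \<and> \<Union>\<D> = D \<and>
     (\<exists>a. (\<forall>A\<in>\<D>. has_asymp_series f z0 A (a A)) \<and>
          (let c = (\<lambda>n::nat. common_coeff \<D> a (int n))
           in conv_radius c > 0 \<and>
              (\<forall>z. ereal (norm (z - z0)) < conv_radius c \<longrightarrow>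
                   (\<lambda>n. c n * (z - z0) ^ n) sums g z)))"

definition poly_series :: "complex poly \<Rightarrow> int \<Rightarrow> complex" where
  "poly_series p n = (if n < 0 then 0 else coeff p (nat n))"

abbreviation right_half_plane :: "complex set" where
  "right_half_plane \<equiv> {\<phi>. Re \<phi> > 0}"

abbreviation left_half_plane :: "complex set" where
  "left_half_plane \<equiv> {\<phi>. Re \<phi> < 0}"

lemma ball_subset_right:
  assumes "r > 0"
  shows "ball z r \<subseteq> right_half_plane \<longleftrightarrow> r \<le> Re z"
proof
  assume *: "ball z r \<subseteq> right_half_plane"
  show "r \<le> Re z"
  proof (rule ccontr)
    assume "\<not> r \<le> Re z"
    define s where "s = max 0 (Re z)"
    have s: "0 \<le> s" "s < r" "Re z \<le> s"
      using \<open>\<not> r \<le> Re z\<close> assms by (auto simp: s_def)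
    have "z - of_real s \<in> ball z r" using s by (simp add: dist_norm)
    hence "Re (z - of_real s) > 0" using * by blast
    thus False using s by simp
  qed
next
  assume "r \<le> Re z"
  show "ball z r \<subseteq> right_half_plane"
  proof
    fix w assume "w \<in> ball z r"
    hence "norm (z - w) < r" by (simp add: dist_norm)
    moreover have "Re (z - w) \<le> norm (z - w)" by (rule complex_Re_le_cmod)
    ultimately show "w \<in> right_half_plane" using \<open>r \<le> Re z\<close> by simp
  qed
qed

lemma approach_region_right:
  assumes "\<epsilon> > 0"
  shows "approach_region right_half_plane 0 \<epsilon> = {\<phi>. \<epsilon> * norm \<phi> \<le> Re \<phi>}"
proof -
  have "ball \<phi> (\<epsilon> * norm \<phi>) \<subseteq> right_half_plane \<longleftrightarrow> \<epsilon> * norm \<phi> \<le> Re \<phi>" for \<phi> :: complex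
  proof (cases "\<phi> = 0")
    case False
    thus ?thesis using assms by (intro ball_subset_right) simp
  qed simp
  thus ?thesis unfolding approach_region_def by simp
qed


section \<open>The series and its expansion\<close>

text \<open>\<open>S_fun m\<close> is the function $S_{2m+2}$.\<close>

definition S_fun :: "nat \<Rightarrow> complex \<Rightarrow> complex" where
  "S_fun m \<phi> =
     (\<Sum>n. \<phi> ^ (2 * m + 2) / sinh (of_nat (Suc n) * \<phi> / 2) ^ (2 * m + 2))"

text \<open>\<open>calB m\<close> is the polynomial $\mathcal B_{2m+2}$.\<close>

definition calB :: "nat \<Rightarrow> complex poly" where
  "calB m = (\<Sum>k\<le>m+1.
     monom (- (2 ^ (2 * m + 1)) *
            ((2 * of_real pi * \<i>) ^ (2 * k) *
             (bernoulli_num (2 * k) / fact (2 * k)) *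
             (gen_bernpoly (2 * m + 2) (2 * m + 2 - 2 * k) (of_nat (m + 1))
                / fact (2 * m + 2 - 2 * k))))
           (2 * m + 2 - 2 * k))"

lemma poly_calB:
  "poly (calB m) \<phi> =
     - (2 ^ (2 * m + 1)) * (\<Sum>k\<le>m+1. (2 * of_real pi * \<i>) ^ (2 * k) *
        (bernoulli_num (2 * k) / fact (2 * k)) *
        (gen_bernpoly (2 * m + 2) (2 * m + 2 - 2 * k) (of_nat (m + 1))
           / fact (2 * m + 2 - 2 * k)) * \<phi> ^ (2 * m + 2 - 2 * k))"
  unfolding calB_def poly_sum poly_monom sum_distrib_left by (simp only: mult.assoc)

text \<open>
  The odd term of the expansion for \<open>Re \<phi> > 0\<close> is $(-1)^{m+1}$ times \<open>odd_coeff m\<close> times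
  $\phi^{2m+1}$. It comes from the finite part of
  $\int_0^\infty \sinh^{-(2m+2)}(x/2)\,dx$, which is
  $(-1)^{m+1}\, 2 \prod_{j=1}^m \frac{2j}{2j+1}$. The value \<open>4 / (m + 2)\<close> found in the
  literature agrees with this only for \<open>m \<le> 1\<close>.
\<close>

definition odd_coeff :: "nat \<Rightarrow> complex" where
  "odd_coeff m = 2 ^ (2 * m + 1) * (fact m)\<^sup>2 / fact (2 * m + 1)"

lemma odd_coeff_le_1: "m \<le> 1 \<Longrightarrow> odd_coeff m = 4 / (of_nat m + 2)"
  by (cases m) (auto simp: odd_coeff_def fact_numeral)

lemma odd_coeff_2: "odd_coeff 2 = 16 / 15" "odd_coeff 2 \<noteq> 4 / (of_nat 2 + 2)"
  by (auto simp: odd_coeff_def fact_numeral power2_eq_square)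

lemma odd_coeff_Suc:
  "odd_coeff (Suc m) = odd_coeff m * (of_nat (2 * m + 2) / of_nat (2 * m + 3))"
proof -
  have f: "fact (2 * Suc m + 1) =
      (of_nat (2 * m + 3) * of_nat (2 * m + 2) * fact (2 * m + 1) :: complex)"
    by (simp add: algebra_simps)
  have g: "fact (Suc m) = (of_nat (Suc m) * fact m :: complex)" by simp
  have h: "(2::complex) ^ (2 * Suc m + 1) = 4 * 2 ^ (2 * m + 1)" by simp
  have e: "of_nat (2 * m + 2) = (2 * of_nat (Suc m) :: complex)"
    by (simp add: algebra_simps)
  have nz: "of_nat (2 * m + 3) \<noteq> (0 :: complex)" "of_nat (Suc m) \<noteq> (0 :: complex)"
    by (simp_all only: of_nat_eq_0_iff)
  show ?thesis
    unfolding odd_coeff_def f g h e using nz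
    by (simp add: divide_simps power2_eq_square del: of_nat_Suc of_nat_add of_nat_mult fact_Suc)
qed

lemma S_fun_summable:
  assumes "Re \<phi> \<noteq> 0"
  shows "summable (\<lambda>n. \<phi> ^ (2 * m + 2) / sinh (of_nat (Suc n) * \<phi> / 2) ^ (2 * m + 2))"
proof -
  define r where "r = \<bar>Re \<phi>\<bar> / 2"
  have r: "r > 0" using assms by (simp add: r_def)
  have sinh_lower: "\<bar>Re z\<bar> \<le> norm (sinh z)" for z :: complex
  proof -
    have x_le: "x \<le> sinh x" if "x \<ge> 0" for x :: real
    proof -
      have "((\<lambda>x. sinh x - x) has_real_derivative (cosh y - 1)) (at y)" for y :: real
        by (auto intro!: derivative_eq_intros)
      hence "sinh 0 - 0 \<le> sinh x - x"
        using that cosh_real_ge_1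
        by (intro DERIV_nonneg_imp_nondecreasing[where f = "\<lambda>x. sinh x - x"]) (force simp: )+
      thus ?thesis by simp
    qed
    have "\<bar>Re z\<bar> \<le> sinh \<bar>Re z\<bar>" by (rule x_le) simp
    also have "\<dots> = \<bar>exp (Re z) - exp (- Re z)\<bar> / 2"
      by (auto simp: sinh_field_def abs_if)
    also have "\<dots> = \<bar>norm (exp z) - norm (exp (- z))\<bar> / 2" by simp
    also have "\<dots> \<le> norm (exp z - exp (- z)) / 2"
      by (intro divide_right_mono norm_triangle_ineq3) simp
    also have "\<dots> = norm (sinh z)" by (simp add: sinh_field_def norm_divide)
    finally show ?thesis .
  qed
  define C where "C = norm \<phi> ^ (2 * m + 2) / r ^ (2 * m + 2)"
  have bound: "norm (\<phi> ^ (2 * m + 2) / sinh (of_nat (Suc n) * \<phi> / 2) ^ (2 * m + 2))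
          \<le> C * inverse (real (Suc n) ^ 2)" for n
  proof -
    have "\<bar>Re (of_nat (Suc n) * \<phi> / 2)\<bar> = real (Suc n) * r"
      by (simp add: r_def abs_mult del: of_nat_Suc)
    hence le: "real (Suc n) * r \<le> norm (sinh (of_nat (Suc n) * \<phi> / 2))"
      using sinh_lower[of "of_nat (Suc n) * \<phi> / 2"] by simp
    have pos: "real (Suc n) * r > 0" using r by simp
    have "norm (\<phi> ^ (2 * m + 2) / sinh (of_nat (Suc n) * \<phi> / 2) ^ (2 * m + 2))
        = norm \<phi> ^ (2 * m + 2) / norm (sinh (of_nat (Suc n) * \<phi> / 2)) ^ (2 * m + 2)"
      by (simp only: norm_divide norm_power)
    also have "\<dots> \<le> norm \<phi> ^ (2 * m + 2) / (real (Suc n) * r) ^ (2 * m + 2)"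
      using le pos r less_le_trans[OF pos le]
      by (intro divide_left_mono power_mono mult_pos_pos zero_less_power) (simp_all del: of_nat_Suc)
    also have "\<dots> = C / real (Suc n) ^ (2 * m + 2)"
      by (simp only: C_def power_mult_distrib) (simp add: field_simps del: of_nat_Suc)
    also have "\<dots> \<le> C / real (Suc n) ^ 2"
      using r by (intro divide_left_mono power_increasing mult_pos_pos) (auto simp: C_def)
    finally show ?thesis by (simp only: divide_inverse)
  qed
  have "summable (\<lambda>n. inverse (real (Suc n) ^ 2))"
    using inverse_power_summable[of 2, where 'a = real] by (subst summable_Suc_iff) simp
  hence "summable (\<lambda>n. C * inverse (real (Suc n) ^ 2))" by (rule summable_mult)
  thus ?thesis by (rule summable_comparison_test') (use bound in blast)
qed

end

(*
  Write p = m + 1 and h(x) = sinh(x/2)^(-2p), so that S(phi) = phi^(2p) * sum_{n>=1} h(n phi).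
  Subtracting the principal part sum_k b_k x^(-2k) of h at 0 leaves an even function f that is
  regular at 0 and O(1/|x|^2), with all its derivatives, in closed sectors around the real axis.
  The principal part contributes the zeta(2k)-terms of the expansion, and Euler's formula turns
  them into Bernoulli numbers. For f, the sum over all integers of phi f(n phi) agrees with the
  integral of f along the line through phi up to O(phi^R) for every R. Since f is even, this sum
  is phi (2 sum_{n>=1} f(n phi) + f(0)): the value f(0) gives the term k = 0, and the integral,
  twice the finite part of the integral of h over the half-line, gives the odd term, whose sign
  depends on the half-plane.
*)
theory Submission
  imports Defs "HOL-Complex_Analysis.Complex_Analysis"
begin

section \<open>Sums over arithmetic progressions and integrals\<close>

text \<open>No integral is ever formed. The integral of f along the line through phi enters only as
  the limit of F(n phi) - F(-n phi) for a primitive F of f, which is all that telescoping Taylor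
  increments can see. This limit is the same for every phi in a sector because F is an explicit
  primitive of h plus odd negative powers of z, and the latter vanish at infinity; this is also why
  only the finite part of the integral of h remains. The reduction formula for powers of csch gives
  the value of that primitive at infinity, and its recursion is the one satisfied by
  \<open>odd_coeff\<close>. The obstacle is the poles 2 pi i k of h: as phi turns towards the
  imaginary axis, the points n phi come close to them. Hence every estimate is made for
  \<open>\<epsilon> * norm z \<le> \<bar>Re z\<bar>\<close> with constants depending on
  \<open>\<epsilon>\<close>, and Cauchy estimates on circles of one fixed radius carry the decay of
  f over to all its derivatives. The left half-plane needs no estimate of its own, since S is
  even.\<close>

lemma suminf_quadratic_decay_bound:
  fixes u :: "nat \<Rightarrow> complex"
  assumes r: "0 < r" "r \<le> 1" and u: "\<And>n. norm (u n) \<le> C / (1 + (real n * r)\<^sup>2)"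
  shows "summable u" and "norm (suminf u) * r\<^sup>2 \<le> C * (\<Sum>n. 1 / (1 + (real n)\<^sup>2))"
proof -
  have "norm (u 0) \<le> C" using u[of 0] by simp
  hence C: "C \<ge> 0" using norm_ge_zero order_trans by blast
  have s: "summable (\<lambda>n. 1 / (1 + (real n)\<^sup>2))"
  proof (rule summable_comparison_test')
    show "summable (\<lambda>n. inverse (real n ^ 2))"
      using inverse_power_summable[of 2, where 'a = real] by simp
    show "norm (1 / (1 + (real n)\<^sup>2)) \<le> inverse (real n ^ 2)" if "n \<ge> 1" for n
      using that by (simp add: inverse_eq_divide frac_le)
  qed
  \<comment> \<open>Since \<open>r \<le> 1\<close>, the terms compare with a series that does not
    depend on \<open>r\<close>. The price is the order \<open>1 / r\<^sup>2\<close> where comparison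
    with an integral would give \<open>1 / r\<close>.\<close>
  have b: "norm (u n) \<le> C / r\<^sup>2 * (1 / (1 + (real n)\<^sup>2))" for n
  proof -
    have "r\<^sup>2 \<le> 1" using r by (simp add: power_le_one)
    hence "r\<^sup>2 * (1 + (real n)\<^sup>2) \<le> 1 + (real n * r)\<^sup>2"
      by (simp add: algebra_simps power_mult_distrib)
    hence "C / (1 + (real n * r)\<^sup>2) \<le> C / (r\<^sup>2 * (1 + (real n)\<^sup>2))"
      using C r by (intro divide_left_mono mult_pos_pos) (auto simp: add_pos_nonneg)
    with u[of n] show ?thesis by simp
  qed
  have s': "summable (\<lambda>n. C / r\<^sup>2 * (1 / (1 + (real n)\<^sup>2)))" by (intro summable_mult s)
  have su: "summable (\<lambda>n. norm (u n))"
    by (rule summable_comparison_test'[OF s', of 0]) (use b in auto)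
  thus "summable u" by (rule summable_norm_cancel)
  have "norm (suminf u) \<le> (\<Sum>n. norm (u n))" by (rule summable_norm[OF su])
  also have "\<dots> \<le> (\<Sum>n. C / r\<^sup>2 * (1 / (1 + (real n)\<^sup>2)))" by (intro suminf_le b su s')
  also have "\<dots> = C / r\<^sup>2 * (\<Sum>n. 1 / (1 + (real n)\<^sup>2))" by (rule suminf_mult[OF s])
  finally show "norm (suminf u) * r\<^sup>2 \<le> C * (\<Sum>n. 1 / (1 + (real n)\<^sup>2))"
    using r by (simp add: field_simps)
qed

text \<open>Pairing n with -(n + 1) visits every integer once and keeps the sum a
  \<open>suminf\<close> over the naturals.\<close>

definition two_sided_sum :: "(complex \<Rightarrow> complex) \<Rightarrow> complex \<Rightarrow> complex" where
  "two_sided_sum f \<phi> = (\<Sum>n. f (of_nat n * \<phi>) + f (- (of_nat (Suc n) * \<phi>)))"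

lemma two_sided_sum_bound:
  assumes b: "\<And>t::real. norm (h (of_real t * \<phi>)) \<le> C / (1 + (norm (of_real t * \<phi>))\<^sup>2)"
    and r: "0 < norm \<phi>" "norm \<phi> \<le> 1"
  shows "summable (\<lambda>n. h (of_nat n * \<phi>) + h (- (of_nat (Suc n) * \<phi>)))"
    and "norm (two_sided_sum h \<phi>) * (norm \<phi>)\<^sup>2 \<le> 2 * C * (\<Sum>n. 1 / (1 + (real n)\<^sup>2))"
proof -
  have "norm (h 0) \<le> C" using b[of 0] by simp
  hence C: "C \<ge> 0" using norm_ge_zero order_trans by blast
  have *: "norm (h (of_nat n * \<phi>) + h (- (of_nat (Suc n) * \<phi>)))
            \<le> 2 * C / (1 + (real n * norm \<phi>)\<^sup>2)" for n
  proof -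
    have 1: "norm (h (of_nat n * \<phi>)) \<le> C / (1 + (real n * norm \<phi>)\<^sup>2)"
      using b[of "real n"] by (simp add: norm_mult)
    have "norm (h (- (of_nat (Suc n) * \<phi>))) \<le> C / (1 + (real (Suc n) * norm \<phi>)\<^sup>2)"
      using b[of "- real (Suc n)"] by (simp add: norm_mult del: of_nat_Suc)
    also have "\<dots> \<le> C / (1 + (real n * norm \<phi>)\<^sup>2)"
      using C r by (intro divide_left_mono mult_pos_pos add_mono power_mono mult_right_mono)
        (auto simp: add_pos_nonneg)
    finally show ?thesis using 1 norm_triangle_ineq[of "h (of_nat n * \<phi>)" "h (- (of_nat (Suc n) * \<phi>))"]
      by simp
  qed
  from suminf_quadratic_decay_bound[OF r *]
  show "summable (\<lambda>n. h (of_nat n * \<phi>) + h (- (of_nat (Suc n) * \<phi>)))"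
    and "norm (two_sided_sum h \<phi>) * (norm \<phi>)\<^sup>2 \<le> 2 * C * (\<Sum>n. 1 / (1 + (real n)\<^sup>2))"
    unfolding two_sided_sum_def by simp_all
qed

text \<open>The increments of \<open>A i\<close> over the steps from \<open>t * \<phi>\<close> to
  \<open>(t + 1) * \<phi>\<close>, t an integer, telescope to \<open>L\<close>. Expanding each
  increment at the left end of its step gives sums of derivatives, and the quadratic decay makes the
  remainders summable.\<close>

lemma two_sided_taylor_telescope:
  fixes A :: "nat \<Rightarrow> complex \<Rightarrow> complex"
  assumes deriv: "\<And>i z. z \<in> X \<Longrightarrow> (A i has_field_derivative A (Suc i) z) (at z)"
    and bound: "\<And>i z. z \<in> X \<Longrightarrow> norm (A (Suc i) z) \<le> C i / (1 + (norm z)\<^sup>2)"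
    and ray: "\<And>t::real. of_real t * \<phi> \<in> X"
    and lim: "(\<lambda>n. A i (of_nat n * \<phi>) - A i (- (of_nat n * \<phi>))) \<longlonglongrightarrow> L"
    and r: "0 < norm \<phi>" "norm \<phi> \<le> 1"
  shows "norm (L - (\<Sum>j=1..J. \<phi> ^ j / fact j * two_sided_sum (A (i + j)) \<phi>)) * (norm \<phi>)\<^sup>2
           \<le> 2 * C (i + J) * (\<Sum>n. 1 / (1 + (real n)\<^sup>2)) * norm \<phi> ^ Suc J"
proof -
  have C: "C k \<ge> 0" for k
  proof -
    have "norm (A (Suc k) 0) \<le> C k" using bound[of 0 k] ray[of 0] by simp
    thus ?thesis using norm_ge_zero order_trans by blast
  qed
  define a where "a = (\<lambda>k n. A k (of_nat n * \<phi>) + A k (- (of_nat (Suc n) * \<phi>)))"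
  define d where "d = (\<lambda>n. (A i (of_nat (Suc n) * \<phi>) - A i (of_nat n * \<phi>))
                        + (A i (- (of_nat n * \<phi>)) - A i (- (of_nat (Suc n) * \<phi>))))"
  \<comment> \<open>The two values of \<open>t\<close> are the left ends of the n-th steps to the
    right and to the left of 0. Both steps stay at distance at least
    \<open>real n * norm \<phi>\<close> from 0.\<close>
  have taylor: "norm (A i (of_real (t + 1) * \<phi>) - A i (of_real t * \<phi>)
        - (\<Sum>j=1..J. \<phi> ^ j / fact j * A (i + j) (of_real t * \<phi>)))
      \<le> C (i + J) / (1 + (real n * norm \<phi>)\<^sup>2) * norm \<phi> ^ Suc J"
    if t: "t = real n \<or> t = - real (Suc n)" for t n
  proof -
    let ?S = "closed_segment (of_real t * \<phi>) (of_real (t + 1) * \<phi>)"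
    have S: "\<exists>s::real. x = of_real s * \<phi> \<and> real n \<le> \<bar>s\<bar>" if x: "x \<in> ?S" for x
    proof -
      from x obtain u where u: "0 \<le> u" "u \<le> 1"
          "x = (1 - u) *\<^sub>R (of_real t * \<phi>) + u *\<^sub>R (of_real (t + 1) * \<phi>)"
        unfolding closed_segment_def by auto
      hence "x = of_real (t + u) * \<phi>" by (simp add: scaleR_conv_of_real algebra_simps)
      moreover have "real n \<le> \<bar>t + u\<bar>" using t u by auto
      ultimately show ?thesis by blast
    qed
    have "cmod (A (i + 0) (of_real (t + 1) * \<phi>) - (\<Sum>j\<le>J. A (i + j) (of_real t * \<phi>) *
              (of_real (t + 1) * \<phi> - of_real t * \<phi>) ^ j / fact j))
          \<le> C (i + J) / (1 + (real n * norm \<phi>)\<^sup>2) *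
             cmod (of_real (t + 1) * \<phi> - of_real t * \<phi>) ^ Suc J / fact J"
    proof (rule complex_Taylor[where S = ?S])
      fix x k assume x: "x \<in> ?S"
      obtain s where s: "x = of_real s * \<phi>" "real n \<le> \<bar>s\<bar>" using S[OF x] by blast
      have xX: "x \<in> X" using ray s by simp
      show "(A (i + k) has_field_derivative A (i + Suc k) x) (at x within ?S)"
        using deriv[OF xX, of "i + k"] by (simp add: has_field_derivative_at_within)
      have "cmod (A (i + Suc J) x) \<le> C (i + J) / (1 + (norm x)\<^sup>2)"
        using bound[OF xX, of "i + J"] by simp
      also have "norm x = \<bar>s\<bar> * norm \<phi>" by (simp add: s norm_mult)
      also have "C (i + J) / (1 + (\<bar>s\<bar> * norm \<phi>)\<^sup>2) \<le> C (i + J) / (1 + (real n * norm \<phi>)\<^sup>2)"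
        using C s by (intro divide_left_mono mult_pos_pos add_mono power_mono mult_right_mono)
          (auto simp: add_pos_nonneg)
      finally show "cmod (A (i + Suc J) x) \<le> C (i + J) / (1 + (real n * norm \<phi>)\<^sup>2)" .
    qed auto
    also have "of_real (t + 1) * \<phi> - of_real t * \<phi> = \<phi>" by (simp add: algebra_simps)
    also have "(\<Sum>j\<le>J. A (i + j) (of_real t * \<phi>) * \<phi> ^ j / fact j)
        = A i (of_real t * \<phi>) + (\<Sum>j=1..J. \<phi> ^ j / fact j * A (i + j) (of_real t * \<phi>))"
      by (simp add: atMost_atLeast0 sum.atLeast_Suc_atMost mult.commute)
    also have "C (i + J) / (1 + (real n * norm \<phi>)\<^sup>2) * cmod \<phi> ^ Suc J / fact J
        \<le> C (i + J) / (1 + (real n * norm \<phi>)\<^sup>2) * cmod \<phi> ^ Suc J / 1"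
      using C by (intro divide_left_mono mult_nonneg_nonneg divide_nonneg_nonneg) auto
    finally show ?thesis by (simp add: diff_diff_eq)
  qed
  define e where "e = (\<lambda>n. d n - (\<Sum>j=1..J. \<phi> ^ j / fact j * a (i + j) n))"
  have e_bound: "norm (e n) \<le> 2 * C (i + J) * norm \<phi> ^ Suc J / (1 + (real n * norm \<phi>)\<^sup>2)" for n
  proof -
    let ?B = "C (i + J) / (1 + (real n * norm \<phi>)\<^sup>2) * norm \<phi> ^ Suc J"
    let ?x = "A i (of_nat (Suc n) * \<phi>) - A i (of_nat n * \<phi>)
        - (\<Sum>j=1..J. \<phi> ^ j / fact j * A (i + j) (of_nat n * \<phi>))"
    let ?y = "A i (- (of_nat n * \<phi>)) - A i (- (of_nat (Suc n) * \<phi>))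
        - (\<Sum>j=1..J. \<phi> ^ j / fact j * A (i + j) (- (of_nat (Suc n) * \<phi>)))"
    have 1: "norm ?x \<le> ?B" using taylor[of "real n" n] by (simp add: add.commute)
    have "complex_of_real (- real (Suc n) + 1) * \<phi> = - (of_nat n * \<phi>)"
        "complex_of_real (- real (Suc n)) * \<phi> = - (of_nat (Suc n) * \<phi>)"
      by (simp_all add: algebra_simps)
    hence 2: "norm ?y \<le> ?B"
      using taylor[OF disjI2[OF refl], of n] by (simp only:)
    have "e n = ?x + ?y"
      by (simp add: e_def d_def a_def sum.distrib distrib_left algebra_simps del: of_nat_Suc)
    hence "norm (e n) \<le> ?B + ?B" using norm_triangle_mono[OF 1 2] by (simp only:)
    also have "\<dots> = 2 * C (i + J) * norm \<phi> ^ Suc J / (1 + (real n * norm \<phi>)\<^sup>2)"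
      by (metis (no_types, lifting) mult_2 mult.assoc times_divide_eq_left times_divide_eq_right)
    finally show ?thesis .
  qed
  \<comment> \<open>The paired increments telescope as differences of
    \<open>A i (of_nat n * \<phi>) - A i (- (of_nat n * \<phi>))\<close>, whose value at n = 0 is
    0.\<close>
  have "d sums (L - (A i (of_nat 0 * \<phi>) - A i (- (of_nat 0 * \<phi>))))"
    using telescope_sums[OF lim] by (simp add: d_def algebra_simps)
  hence d: "d sums L" by simp
  have a: "a (i + j) sums two_sided_sum (A (i + j)) \<phi>" if j: "j \<ge> 1" for j
  proof -
    obtain k where "j = Suc k" using j by (cases j) auto
    hence k: "i + j = Suc (i + k)" by simp
    have b: "norm (A (i + j) (of_real t * \<phi>)) \<le> C (i + k) / (1 + (norm (of_real t * \<phi>))\<^sup>2)" for t :: real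
      unfolding k by (rule bound[OF ray])
    have "summable (a (i + j))" unfolding a_def
      by (rule two_sided_sum_bound(1)[OF b r])
    thus ?thesis unfolding a_def two_sided_sum_def by (rule summable_sums)
  qed
  have "e sums (L - (\<Sum>j=1..J. \<phi> ^ j / fact j * two_sided_sum (A (i + j)) \<phi>))"
    unfolding e_def by (intro sums_diff d sums_sum sums_mult a) auto
  hence "suminf e = L - (\<Sum>j=1..J. \<phi> ^ j / fact j * two_sided_sum (A (i + j)) \<phi>)"
    by (rule sums_unique[symmetric])
  thus ?thesis using suminf_quadratic_decay_bound(2)[OF r e_bound] by (simp add: mult_ac)
qed

text \<open>
  By Taylor expansion, \<open>\<phi> \<Sum> A (i + 1)\<close> equals its limit up to the sums of the higher derivatives with
  extra powers of \<open>\<phi>\<close>. These have limit \<open>0\<close>, so a bound \<open>O(\<phi>\<^sup>R)\<close> for all derivatives at once improves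
  itself to \<open>O(\<phi>\<^sup>R\<^sup>+\<^sup>1)\<close>; no Bernoulli numbers are needed. The factor \<open>norm \<phi>\<close> on the left makes the
  case \<open>R = 0\<close> trivial.
\<close>

theorem two_sided_sum_approximates_integral:
  fixes A :: "nat \<Rightarrow> complex \<Rightarrow> complex"
  assumes deriv: "\<And>i z. z \<in> X \<Longrightarrow> (A i has_field_derivative A (Suc i) z) (at z)"
    and bound: "\<And>i z. z \<in> X \<Longrightarrow> norm (A (Suc i) z) \<le> C i / (1 + (norm z)\<^sup>2)"
    and ray: "\<And>\<phi> t::real. \<phi> \<in> \<Phi> \<Longrightarrow> of_real t * \<phi> \<in> X"
    and lim: "\<And>\<phi>. \<phi> \<in> \<Phi> \<Longrightarrow> \<phi> \<noteq> 0 \<Longrightarrow> (\<lambda>n. A 0 (of_nat n * \<phi>) - A 0 (- (of_nat n * \<phi>))) \<longlonglongrightarrow> L"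
  shows "\<exists>K. \<forall>\<phi>\<in>\<Phi>. 0 < norm \<phi> \<longrightarrow> norm \<phi> \<le> 1 \<longrightarrow>
           norm (\<phi> * two_sided_sum (A 1) \<phi> - L) * norm \<phi> \<le> K * norm \<phi> ^ R"
proof -
  define K where "K = (\<Sum>n. 1 / (1 + (real n)\<^sup>2))"
  \<comment> \<open>Only the primitive \<open>A 0\<close> has a nonzero difference of limits at the
    two ends; all later \<open>A i\<close> decay.\<close>
  define l where "l = (\<lambda>i::nat. if i = 0 then L else 0)"
  define Q where "Q = (\<lambda>i \<phi>. \<phi> * two_sided_sum (A (Suc i)) \<phi> - l i)"
  have lim': "(\<lambda>n. A i (of_nat n * \<phi>) - A i (- (of_nat n * \<phi>))) \<longlonglongrightarrow> l i"
    if \<phi>: "\<phi> \<in> \<Phi>" "\<phi> \<noteq> 0" for \<phi> i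
  proof (cases i)
    case 0 thus ?thesis using lim[OF \<phi>] by (simp add: l_def)
  next
    case (Suc k)
    have sq: "filterlim (\<lambda>n. (real n * norm \<phi>)\<^sup>2) at_top sequentially"
      using \<phi> by (intro filterlim_pow_at_top filterlim_at_top_mult_tendsto_pos[OF tendsto_const]
        filterlim_real_sequentially) auto
    have z: "((\<lambda>n. C k / (1 + (real n * norm \<phi>)\<^sup>2)) \<longlongrightarrow> 0) sequentially"
      by (intro tendsto_divide_0[OF tendsto_const] filterlim_at_top_imp_at_infinity
          filterlim_tendsto_add_at_top[OF tendsto_const] sq)
    have "norm (A i (of_nat n * \<phi>)) \<le> C k / (1 + (real n * norm \<phi>)\<^sup>2)"
        "norm (A i (- (of_nat n * \<phi>))) \<le> C k / (1 + (real n * norm \<phi>)\<^sup>2)" for n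
      using bound[OF ray[OF \<phi>(1), of "real n"], of k] bound[OF ray[OF \<phi>(1), of "- real n"], of k]
      by (simp_all add: Suc norm_mult)
    note b = this
    have "(\<lambda>n. A i (of_nat n * \<phi>)) \<longlonglongrightarrow> 0" "(\<lambda>n. A i (- (of_nat n * \<phi>))) \<longlonglongrightarrow> 0"
      by (rule Lim_null_comparison[OF always_eventually[OF allI] z], rule b)+
    from tendsto_diff[OF this] show ?thesis by (simp add: l_def Suc)
  qed
  have "\<exists>M. \<forall>\<phi>\<in>\<Phi>. 0 < norm \<phi> \<longrightarrow> norm \<phi> \<le> 1 \<longrightarrow> norm (Q i \<phi>) * norm \<phi> \<le> M * norm \<phi> ^ R" for i
  proof (induction R arbitrary: i)
    case 0
    have "norm (Q i \<phi>) * norm \<phi> \<le> 2 * C i * K + norm (l i)"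
      if \<phi>: "\<phi> \<in> \<Phi>" "0 < norm \<phi>" "norm \<phi> \<le> 1" for \<phi>
    proof -
      have "norm (two_sided_sum (A (Suc i)) \<phi>) * (norm \<phi>)\<^sup>2 \<le> 2 * C i * K"
        unfolding K_def by (rule two_sided_sum_bound(2)) (use bound ray \<phi> in auto)
      moreover have "norm (Q i \<phi>) \<le> norm \<phi> * norm (two_sided_sum (A (Suc i)) \<phi>) + norm (l i)"
        unfolding Q_def by (metis norm_mult norm_triangle_ineq4)
      hence "norm (Q i \<phi>) * norm \<phi>
          \<le> (norm \<phi> * norm (two_sided_sum (A (Suc i)) \<phi>) + norm (l i)) * norm \<phi>"
        by (intro mult_right_mono) auto
      moreover have "norm (l i) * norm \<phi> \<le> norm (l i)" using \<phi> by (simp add: mult_left_le)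
      ultimately show ?thesis by (simp add: algebra_simps power2_eq_square)
    qed
    thus ?case by auto
  next
    case (Suc R)
    then obtain M where M: "\<And>i \<phi>. \<phi> \<in> \<Phi> \<Longrightarrow> 0 < norm \<phi> \<Longrightarrow> norm \<phi> \<le> 1 \<Longrightarrow>
        norm (Q i \<phi>) * norm \<phi> \<le> M i * norm \<phi> ^ R" by metis
    \<comment> \<open>The telescoping bound has exponent \<open>Suc J\<close> against a factor
      \<open>(norm \<phi>)\<^sup>2\<close>. Cancelling one \<open>norm \<phi>\<close> leaves
      exponent \<open>J\<close>, so this choice is just enough for \<open>Suc R\<close>.\<close>
    define J where "J = Suc R"
    have "norm (Q i \<phi>) * norm \<phi> \<le> ((\<Sum>j=2..J. \<bar>M (i + j - 1)\<bar>) + 2 * C (i + J) * K) * norm \<phi> ^ Suc R"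
      if \<phi>: "\<phi> \<in> \<Phi>" "0 < norm \<phi>" "norm \<phi> \<le> 1" for \<phi>
    proof -
      let ?T = "\<lambda>j. two_sided_sum (A (i + j)) \<phi>"
      define E where "E = l i - (\<Sum>j=1..J. \<phi> ^ j / fact j * ?T j)"
      have "norm E * (norm \<phi>)\<^sup>2 \<le> 2 * C (i + J) * K * norm \<phi> ^ Suc J"
        unfolding E_def K_def
        by (rule two_sided_taylor_telescope[where X = X]) (use deriv bound ray \<phi> lim' in auto)
      hence E: "norm E * norm \<phi> \<le> 2 * C (i + J) * K * norm \<phi> ^ Suc R"
        using \<phi> by (simp add: power2_eq_square J_def)
      have "(\<Sum>j=1..J. \<phi> ^ j / fact j * ?T j) = \<phi> * ?T 1 + (\<Sum>j=2..J. \<phi> ^ j / fact j * ?T j)"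
        unfolding J_def by (subst sum.atLeast_Suc_atMost) (auto simp: numeral_2_eq_2)
      \<comment> \<open>Here \<open>i + j - 1\<close> is positive, so \<open>l\<close> vanishes
        there and the sum is itself an error term \<open>Q\<close>. Each such term keeps a factor
        \<open>\<phi>\<close>, which is the power gained over the induction hypothesis.\<close>
      also have "(\<Sum>j=2..J. \<phi> ^ j / fact j * ?T j) = (\<Sum>j=2..J. \<phi> ^ (j - 1) / fact j * Q (i + j - 1) \<phi>)"
      proof (intro sum.cong refl)
        fix j assume "j \<in> {2..J}"
        then obtain k where k: "j = Suc (Suc k)" by (metis atLeastAtMost_iff Suc_le_D numeral_2_eq_2 Suc_le_mono)
        show "\<phi> ^ j / fact j * ?T j = \<phi> ^ (j - 1) / fact j * Q (i + j - 1) \<phi>"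
          unfolding k Q_def l_def by simp
      qed
      finally have Q: "Q i \<phi> = - E - (\<Sum>j=2..J. \<phi> ^ (j - 1) / fact j * Q (i + j - 1) \<phi>)"
        by (simp add: Q_def E_def)
      have "norm (Q i \<phi>) \<le> norm E + (\<Sum>j=2..J. norm (\<phi> ^ (j - 1) / fact j * Q (i + j - 1) \<phi>))"
        unfolding Q by (rule order_trans[OF norm_triangle_ineq4]) (simp add: norm_sum)
      hence "norm (Q i \<phi>) * norm \<phi> \<le>
          (norm E + (\<Sum>j=2..J. norm (\<phi> ^ (j - 1) / fact j * Q (i + j - 1) \<phi>))) * norm \<phi>"
        by (intro mult_right_mono) auto
      also have "\<dots> = norm E * norm \<phi>
          + (\<Sum>j=2..J. norm (\<phi> ^ (j - 1) / fact j) * (norm (Q (i + j - 1) \<phi>) * norm \<phi>))"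
        by (simp add: distrib_right sum_distrib_right norm_mult norm_divide mult.assoc)
      also have "(\<Sum>j=2..J. norm (\<phi> ^ (j - 1) / fact j) * (norm (Q (i + j - 1) \<phi>) * norm \<phi>))
          \<le> (\<Sum>j=2..J. norm \<phi> * (\<bar>M (i + j - 1)\<bar> * norm \<phi> ^ R))"
      proof (rule sum_mono, rule mult_mono)
        fix j assume j: "j \<in> {2..J}"
        have "norm \<phi> ^ (j - 1) / fact j \<le> norm \<phi> ^ (j - 1) / 1"
          by (intro divide_left_mono) auto
        also have "\<dots> \<le> norm \<phi> ^ 1" using j \<phi> unfolding div_by_1 by (intro power_decreasing) auto
        finally show "norm (\<phi> ^ (j - 1) / fact j) \<le> norm \<phi>" by (simp add: norm_divide norm_power)
        have "norm (Q (i + j - 1) \<phi>) * norm \<phi> \<le> M (i + j - 1) * norm \<phi> ^ R" by (rule M[OF \<phi>])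
        also have "\<dots> \<le> \<bar>M (i + j - 1)\<bar> * norm \<phi> ^ R" by (intro mult_right_mono) auto
        finally show "norm (Q (i + j - 1) \<phi>) * norm \<phi> \<le> \<bar>M (i + j - 1)\<bar> * norm \<phi> ^ R" .
      qed auto
      also have "\<dots> = (\<Sum>j=2..J. \<bar>M (i + j - 1)\<bar>) * norm \<phi> ^ Suc R"
        by (simp add: sum_distrib_right sum_distrib_left mult_ac)
      finally show ?thesis using E unfolding distrib_right by linarith
    qed
    thus ?case by blast
  qed
  from this[of 0] show ?thesis by (simp add: Q_def l_def)
qed

section \<open>Even zeta values\<close>

abbreviation bernoulli_fps :: "complex fps" where
  "bernoulli_fps \<equiv> fps_X / (fps_exp 1 - 1)"

text \<open>Numerator and denominator both have subdegree 1, so the formal quotient corresponds to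
  the analytic one with its removable singularity filled by 1.\<close>

lemma bernoulli_fps_expansion:
  "(\<lambda>z. if z = 0 then 1 else z / (exp z - 1)) has_fps_expansion bernoulli_fps"
proof -
  have s: "subdegree (fps_exp 1 - 1 :: complex fps) = 1" by (rule subdegreeI) auto
  hence nz: "fps_exp 1 - 1 \<noteq> (0 :: complex fps)" by force
  have "(\<lambda>z::complex. exp z - 1) has_fps_expansion (fps_exp 1 - 1)"
    by (intro fps_expansion_intros)
  from has_fps_expansion_divide[OF has_fps_expansion_fps_X this _ nz, of 1]
  show ?thesis unfolding s by simp
qed

lemma bernoulli_fps_expansion_scaled:
  assumes "c \<noteq> 0"
  shows "(\<lambda>z. if z = 0 then 1 else c * z / (exp (c * z) - 1)) has_fps_expansion
           Abs_fps (\<lambda>n. c ^ n * fps_nth bernoulli_fps n)"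
proof -
  have "((\<lambda>z. if z = 0 then 1 else z / (exp z - 1)) \<circ> (\<lambda>z. c * z)) has_fps_expansion
          fps_compose bernoulli_fps (fps_const c * fps_X)"
    by (intro has_fps_expansion_compose bernoulli_fps_expansion fps_expansion_intros) auto
  thus ?thesis using assms by (simp add: o_def fps_compose_linear)
qed

text \<open>Both sides are pi z cot(pi z) - 1. The left side comes from differentiating the
  reflection formula, stated for the entire function \<open>rGamma\<close>; the right side is the
  Bernoulli generating function at 2 pi i z, up to elementary terms.\<close>

lemma Digamma_reflection_cot:
  fixes z :: complex
  assumes z: "z \<noteq> 0" "norm z < 1"
  shows "z * (Digamma (1 - z) - Digamma (1 + z))
           = 2 * of_real pi * \<i> * z / (exp (2 * of_real pi * \<i> * z) - 1) + of_real pi * \<i> * z - 1"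
proof -
  have nonint: "1 + w \<notin> \<int>\<^sub>\<le>\<^sub>0" if "norm w < 1" for w :: complex
  proof
    assume "1 + w \<in> \<int>\<^sub>\<le>\<^sub>0"
    then obtain n where n: "1 + w = - of_nat n" by (auto elim!: nonpos_Ints_cases')
    hence "w = of_real (- real (Suc n))" by (simp add: algebra_simps eq_neg_iff_add_eq_0)
    hence "norm w = \<bar>- real (Suc n)\<bar>" by (simp only: norm_of_real)
    thus False using that by simp
  qed
  \<comment> \<open>Shifting both arguments by 1 makes the reflection formula usable near 0, where
    it would otherwise contain a double zero.\<close>
  have eq: "w * rGamma (1 + w) * rGamma (1 - w) = sin (of_real pi * w) / of_real pi" for w :: complex
  proof (cases "w = 0")
    case False
    have "w * rGamma (w + 1) * (- w * rGamma (- w + 1)) = - w * sin (of_real pi * w) / of_real pi"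
      unfolding rGamma_plus1 by (rule rGamma_reflection_complex')
    thus ?thesis using False by (simp add: field_simps)
  qed auto
  have 1: "1 + z \<notin> \<int>\<^sub>\<le>\<^sub>0" "1 - z \<notin> \<int>\<^sub>\<le>\<^sub>0" using nonint[of z] nonint[of "-z"] z by auto
  have "((\<lambda>w. w * rGamma (1 + w) * rGamma (1 - w)) has_field_derivative
          rGamma (1 + z) * rGamma (1 - z) * (1 + z * (Digamma (1 - z) - Digamma (1 + z)))) (at z)"
    using 1 by (auto intro!: derivative_eq_intros simp: algebra_simps)
  moreover have "((\<lambda>w. w * rGamma (1 + w) * rGamma (1 - w)) has_field_derivative cos (of_real pi * z)) (at z)"
    unfolding eq by (auto intro!: derivative_eq_intros)
  ultimately have d: "rGamma (1 + z) * rGamma (1 - z) * (1 + z * (Digamma (1 - z) - Digamma (1 + z)))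
      = cos (of_real pi * z)" by (rule DERIV_unique)
  have sn: "sin (of_real pi * z) \<noteq> 0"
  proof -
    have "rGamma (1 + z) \<noteq> 0" "rGamma (1 - z) \<noteq> 0" using 1 by (auto simp: rGamma_eq_zero_iff)
    thus ?thesis using eq[of z] z by auto
  qed
  define E where "E = exp (\<i> * (of_real pi * z))"
  have E: "E \<noteq> 0" by (simp add: E_def)
  have sE: "sin (of_real pi * z) = (E - 1 / E) / (2 * \<i>)"
    and cE: "cos (of_real pi * z) = (E + 1 / E) / 2"
    by (simp_all add: sin_exp_eq cos_exp_eq E_def exp_minus field_simps)
  have EE: "exp (2 * of_real pi * \<i> * z) = E\<^sup>2"
    by (simp add: E_def exp_double[symmetric] mult_ac)
  have E2: "E\<^sup>2 - 1 \<noteq> 0"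
    using sn E unfolding sE by (auto simp: power2_eq_square field_simps)
  have "(1 + z * (Digamma (1 - z) - Digamma (1 + z))) * (sin (of_real pi * z) / of_real pi)
      = z * cos (of_real pi * z)"
    unfolding eq[symmetric] d[symmetric] by (simp add: mult_ac)
  hence "1 + z * (Digamma (1 - z) - Digamma (1 + z)) = of_real pi * z * cos (of_real pi * z) / sin (of_real pi * z)"
    using sn by (simp add: field_simps)
  also have "\<dots> = of_real pi * \<i> * z * (E\<^sup>2 + 1) / (E\<^sup>2 - 1)"
    unfolding sE cE using E E2 by (simp add: field_simps power2_eq_square)
  also have "\<dots> = 2 * of_real pi * \<i> * z / (E\<^sup>2 - 1) + of_real pi * \<i> * z"
    using E2 by (simp add: field_simps)
  finally show ?thesis unfolding EE by (simp add: algebra_simps)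
qed

text \<open>Comparison of Taylor coefficients in \<open>Digamma_reflection_cot\<close>: the
  derivatives of Digamma at 1 are Polygamma values, that is, zeta series up to sign and
  factorial.\<close>

lemma even_zeta_sums:
  assumes k: "k \<ge> 1"
  shows "(\<lambda>n. 1 / of_nat (Suc n) ^ (2 * k)) sums
           (- ((2 * of_real pi * \<i>) ^ (2 * k) * (bernoulli_num (2 * k) / fact (2 * k))) / 2)"
proof -
  define c :: complex where "c = 2 * of_real pi * \<i>"
  have c: "c \<noteq> 0" by (simp add: c_def)
  define D where "D = (\<lambda>z::complex. Digamma (1 - z) - Digamma (1 + z))"
  let ?S = "ball (0::complex) 1" and ?T = "{z::complex. Re z > 0}"
  have T: "Digamma holomorphic_on ?T" "open ?T"
    by (auto intro!: holomorphic_intros open_halfspace_Re_gt elim!: nonpos_Ints_cases)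
  have S: "1 - z \<in> ?T" "1 + z \<in> ?T" if "z \<in> ?S" for z
    using that abs_Re_le_cmod[of z] by auto
  have h1: "(\<lambda>z. Digamma (1 - z)) holomorphic_on ?S" "(\<lambda>z. Digamma (1 + z)) holomorphic_on ?S"
    by (rule holomorphic_on_compose_gen[OF _ T(1), unfolded o_def], intro holomorphic_intros, use S in blast)+
  hence hol: "D holomorphic_on ?S" unfolding D_def by (intro holomorphic_intros)
  have deriv: "(deriv ^^ n) D 0 = (-1) ^ n * Polygamma n 1 - Polygamma n 1" for n
  proof -
    have "(deriv ^^ n) D 0 = (deriv ^^ n) (\<lambda>z. Digamma ((-1) * z + 1)) 0 - (deriv ^^ n) (\<lambda>z. Digamma (1 * z + 1)) 0"
      unfolding D_def by (subst higher_deriv_diff[OF h1]) (auto simp: algebra_simps)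
    also have "(deriv ^^ n) (\<lambda>z::complex. Digamma ((-1) * z + 1)) 0 = (-1) ^ n * (deriv ^^ n) Digamma ((-1) * 0 + 1)"
      using higher_deriv_compose_linear'[where S = ?S and u = "-1" and c = 1 and z = 0 and n = n, OF T(1) open_ball T(2)] S
      by simp
    also have "(deriv ^^ n) (\<lambda>z::complex. Digamma (1 * z + 1)) 0 = 1 ^ n * (deriv ^^ n) Digamma (1 * 0 + 1)"
      using higher_deriv_compose_linear'[where S = ?S and u = 1 and c = 1 and z = 0 and n = n, OF T(1) open_ball T(2)] S
      by (simp add: add.commute)
    finally show ?thesis by (simp add: higher_deriv_Polygamma)
  qed
  have "D has_fps_expansion fps_expansion D 0"
    by (rule has_fps_expansion_fps_expansion[of ?S]) (use hol in auto)
  hence 1: "(\<lambda>z. z * D z) has_fps_expansion fps_X * fps_expansion D 0"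
    by (intro fps_expansion_intros)
  \<comment> \<open>The extra linear and constant terms do not reach the coefficients of index
    \<open>2 * k \<ge> 2\<close>.\<close>
  let ?F = "Abs_fps (\<lambda>n. c ^ n * fps_nth bernoulli_fps n) + fps_const (c / 2) * fps_X - 1"
  have "(\<lambda>z. (if z = 0 then 1 else c * z / (exp (c * z) - 1)) + c / 2 * z - 1) has_fps_expansion ?F"
    by (intro fps_expansion_intros bernoulli_fps_expansion_scaled c)
  moreover have "eventually (\<lambda>z. z \<in> ?S) (nhds 0)" by (intro eventually_nhds_in_open) auto
  hence "eventually (\<lambda>z. (if z = 0 then 1 else c * z / (exp (c * z) - 1)) + c / 2 * z - 1 = z * D z) (nhds 0)"
    by eventually_elim (use Digamma_reflection_cot in \<open>auto simp: c_def D_def\<close>)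
  ultimately have 2: "(\<lambda>z. z * D z) has_fps_expansion ?F"
    by (subst (asm) has_fps_expansion_cong[OF _ refl]) auto
  have F: "fps_X * fps_expansion D 0 = ?F" by (rule fps_expansion_unique_complex[OF 1 2])
  obtain j where j: "k = Suc j" using k by (cases k) auto
  \<comment> \<open>The factor \<open>fps_X\<close> shifts the index to the odd number
    \<open>2 * j + 1\<close>, where the two contributions to the derivative of \<open>D\<close> add
    up instead of cancelling.\<close>
  have "fps_nth (fps_X * fps_expansion D 0) (2 * k) = - 2 * Polygamma (2 * j + 1) 1 / fact (2 * j + 1)"
    by (simp add: fps_expansion_def deriv j)
  also have "fps_nth (fps_X * fps_expansion D 0) (2 * k) = c ^ (2 * k) * fps_nth bernoulli_fps (2 * k)"
    unfolding F by (simp add: j)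
  also have "fps_nth bernoulli_fps (2 * k) = bernoulli_num (2 * k) / fact (2 * k)"
    by (simp add: bernoulli_num_def gen_bernpoly_def)
  finally have P: "Polygamma (2 * j + 1) 1 / fact (2 * j + 1)
      = - (c ^ (2 * k) * (bernoulli_num (2 * k) / fact (2 * k))) / 2" by simp
  have "(\<lambda>n. inverse ((1 + of_nat n) ^ Suc (2 * j + 1))) sums
          ((-1) ^ Suc (2 * j + 1) * Polygamma (2 * j + 1) (1::complex) / fact (2 * j + 1))"
    by (rule Polygamma_LIMSEQ) auto
  also have "(-1) ^ Suc (2 * j + 1) * Polygamma (2 * j + 1) (1::complex) / fact (2 * j + 1)
      = - (c ^ (2 * k) * (bernoulli_num (2 * k) / fact (2 * k))) / 2" using P by simp
  finally show ?thesis by (simp add: j c_def inverse_eq_divide)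
qed

section \<open>Powers of the hyperbolic cosecant\<close>

text \<open>The reverse triangle inequality for exp(z) and exp(-z) reduces this to the real sinh. A
  linear bound is weak, but raised to the power \<open>2 * m + 2\<close> it yields the quadratic
  decay that the summation argument asks for.\<close>

lemma abs_Re_le_norm_sinh: "\<bar>Re z\<bar> \<le> norm (sinh z)"
proof -
  have x_le: "x \<le> sinh x" if "x \<ge> 0" for x :: real
  proof -
    have "((\<lambda>x. sinh x - x) has_real_derivative (cosh y - 1)) (at y)" for y :: real
      by (auto intro!: derivative_eq_intros)
    hence "sinh 0 - 0 \<le> sinh x - x"
      using that cosh_real_ge_1
      by (intro DERIV_nonneg_imp_nondecreasing[where f = "\<lambda>x. sinh x - x"]) force+
    thus ?thesis by simp
  qed
  have "\<bar>Re z\<bar> \<le> sinh \<bar>Re z\<bar>" by (rule x_le) simp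
  also have "\<dots> = \<bar>norm (exp z) - norm (exp (- z))\<bar> / 2"
    by (auto simp: sinh_field_def abs_if)
  also have "\<dots> \<le> norm (exp z - exp (- z)) / 2"
    by (intro divide_right_mono norm_triangle_ineq3) simp
  also have "\<dots> = norm (sinh z)" by (simp add: sinh_field_def norm_divide)
  finally show ?thesis .
qed

text \<open>
  The plane slit along the imaginary axis from \<open>\<plusminus>2\<pi>i\<close> outwards: it is starlike about \<open>0\<close> and avoids
  the poles \<open>2\<pi>ik\<close> with \<open>k \<noteq> 0\<close>.
\<close>

definition slit_domain :: "complex set" where
  "slit_domain = {z. Re z \<noteq> 0 \<or> \<bar>Im z\<bar> < 2 * pi}"

lemma slit_domain: "open slit_domain" "0 \<in> slit_domain" "uminus ` slit_domain = slit_domain"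
proof -
  show "open slit_domain" unfolding slit_domain_def
    by (intro open_Collect_disj open_Collect_neq open_Collect_less continuous_intros)
  show "0 \<in> slit_domain" by (simp add: slit_domain_def)
  show "uminus ` slit_domain = slit_domain"
    by (auto simp: slit_domain_def image_iff intro!: exI[of _ "- _"] bexI[of _ "- _"])
qed

lemma starlike_slit_domain: "starlike slit_domain"
  unfolding starlike_def
proof (intro bexI[of _ 0] ballI subsetI)
  fix z w assume z: "z \<in> slit_domain" and w: "w \<in> closed_segment 0 z"
  then obtain u where u: "0 \<le> u" "u \<le> 1" "w = of_real u * z"
    by (auto simp: closed_segment_def scaleR_conv_of_real)
  have "u * \<bar>Im z\<bar> \<le> \<bar>Im z\<bar>" using u by (simp add: mult_left_le_one_le)
  thus "w \<in> slit_domain" using z u by (auto simp: slit_domain_def abs_mult)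
qed (rule slit_domain(2))

lemma sinh_half_nonzero:
  assumes "z \<in> slit_domain" "z \<noteq> 0"
  shows "sinh (z / 2) \<noteq> 0"
proof
  assume "sinh (z / 2) = 0"
  hence "exp (z / 2) = exp (- (z / 2))" by (simp add: sinh_field_def)
  hence "exp (z / 2) * exp (z / 2) = exp (- (z / 2)) * exp (z / 2)" by simp
  hence "exp z = 1" by (simp add: exp_add[symmetric])
  then obtain n :: int where n: "Re z = 0" "Im z = of_int (2 * n) * pi"
    by (auto simp: exp_eq_1)
  hence "\<bar>of_int n\<bar> * (2 * pi) < 1 * (2 * pi)" using assms by (simp add: slit_domain_def abs_mult)
  hence "\<bar>of_int n :: real\<bar> < 1" by (subst (asm) mult_less_cancel_right) auto
  hence "n = 0" by linarith
  thus False using n assms by (auto simp: complex_eq_iff)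
qed

section \<open>Explicit primitives and their values at infinity\<close>

text \<open>The reduction formula for integrals of even powers of csch(z/2): differentiating cosh /
  sinh^(2m+3) and using cosh^2 = sinh^2 + 1 produces exactly the powers 2m+2 and 2m+4. With all
  constants of integration 0 the primitives are odd.\<close>

primrec csch_primitive :: "nat \<Rightarrow> complex \<Rightarrow> complex" where
  "csch_primitive 0 z = - 2 * (cosh (z / 2) / sinh (z / 2))"
| "csch_primitive (Suc m) z = - 2 / of_nat (2 * m + 3) *
     (cosh (z / 2) / sinh (z / 2) ^ (2 * m + 3) + of_nat (Suc m) * csch_primitive m z)"

lemma csch_primitive_derivative:
  assumes "sinh (z / 2) \<noteq> 0"
  shows "(csch_primitive m has_field_derivative 1 / sinh (z / 2) ^ (2 * m + 2)) (at z)"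
proof (induction m)
  case 0
  have "((\<lambda>z. - 2 * (cosh (z / 2) / sinh (z / 2))) has_field_derivative
      - ((sinh (z / 2))\<^sup>2 - (cosh (z / 2))\<^sup>2) / (sinh (z / 2))\<^sup>2) (at z)"
    using assms by (auto intro!: derivative_eq_intros simp: power2_eq_square field_simps)
  thus ?case by (simp add: cosh_square_eq) (simp add: power2_eq_square)
next
  case (Suc m)
  define s c where "s = sinh (z / 2)" and "c = cosh (z / 2)"
  have s: "s \<noteq> 0" using assms by (simp add: s_def)
  have c: "c\<^sup>2 = s\<^sup>2 + 1" by (simp add: s_def c_def cosh_square_eq)
  define N :: complex where "N = of_nat (2 * m + 3)"
  have N: "N \<noteq> 0" unfolding N_def by (simp only: of_nat_eq_0_iff)
  have M: "of_nat (Suc m) = (N - 1) / 2" by (simp add: N_def field_simps)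
  have "((\<lambda>z. cosh (z / 2) / sinh (z / 2) ^ (2 * m + 3)) has_field_derivative
      (s / 2 * s ^ (2 * m + 3) - c * (N * (c / 2 * s ^ (2 * m + 2)))) / (s ^ (2 * m + 3) * s ^ (2 * m + 3))) (at z)"
    using assms unfolding s_def c_def N_def
    by (intro DERIV_divide) (auto intro!: derivative_eq_intros simp: field_simps)
  also have "(s / 2 * s ^ (2 * m + 3) - c * (N * (c / 2 * s ^ (2 * m + 2)))) / (s ^ (2 * m + 3) * s ^ (2 * m + 3))
      = (s\<^sup>2 - N * c\<^sup>2) / (2 * s ^ (2 * m + 4))"
    using s by (simp add: divide_simps power_add eval_nat_numeral) (simp add: algebra_simps)
  finally have 1: "((\<lambda>z. cosh (z / 2) / sinh (z / 2) ^ (2 * m + 3)) has_field_derivative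
      (s\<^sup>2 - N * c\<^sup>2) / (2 * s ^ (2 * m + 4))) (at z)" .
  have "((\<lambda>z. of_nat (Suc m) * csch_primitive m z) has_field_derivative (N - 1) / 2 * (1 / s ^ (2 * m + 2))) (at z)"
    unfolding M[symmetric] s_def by (rule DERIV_cmult[OF Suc])
  from DERIV_cmult[OF DERIV_add[OF 1 this], of "- 2 / N"]
  have "(csch_primitive (Suc m) has_field_derivative
      - 2 / N * ((s\<^sup>2 - N * c\<^sup>2) / (2 * s ^ (2 * m + 4)) + (N - 1) / 2 * (1 / s ^ (2 * m + 2)))) (at z)"
    by (simp only: csch_primitive.simps[abs_def] N_def)
  also have "- 2 / N * ((s\<^sup>2 - N * c\<^sup>2) / (2 * s ^ (2 * m + 4)) + (N - 1) / 2 * (1 / s ^ (2 * m + 2)))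
      = 1 / s ^ (2 * Suc m + 2)"
    unfolding c using s N by (simp add: divide_simps power_add eval_nat_numeral) (simp add: algebra_simps)
  finally show ?case by (simp only: s_def)
qed

lemma csch_primitive_odd: "csch_primitive m (- z) = - csch_primitive m z"
proof (induction m)
  case (Suc m)
  have "odd (2 * m + 3)" by simp
  hence "sinh (- z / 2) ^ (2 * m + 3) = - (sinh (z / 2) ^ (2 * m + 3))"
    by (simp add: power_minus_odd)
  thus ?case unfolding csch_primitive.simps Suc
    by (simp add: algebra_simps del: of_nat_Suc of_nat_add power_Suc)
qed simp

text \<open>At infinity coth tends to 1 and the terms with further powers of 1/sinh vanish. The
  recursion then multiplies the limit by -(2m+2)/(2m+3), which is \<open>odd_coeff_Suc\<close> with
  a change of sign.\<close>

lemma csch_primitive_limit: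
  assumes \<phi>: "Re \<phi> > 0"
  shows "(\<lambda>n. csch_primitive m (of_nat n * \<phi>)) \<longlonglongrightarrow> (-1) ^ (m + 1) * odd_coeff m"
proof -
  let ?s = "\<lambda>n. sinh (of_nat n * \<phi> / 2)" and ?c = "\<lambda>n. cosh (of_nat n * \<phi> / 2)"
  have s: "?s n \<noteq> 0" if "n > 0" for n
    using that \<phi> by (intro sinh_half_nonzero) (auto simp: slit_domain_def)
  have inv: "(\<lambda>n. 1 / ?s n) \<longlonglongrightarrow> 0"
  proof (rule Lim_null_comparison)
    show "\<forall>\<^sub>F n in sequentially. norm (1 / ?s n) \<le> 2 / Re \<phi> * inverse (real n)"
      using eventually_gt_at_top[of 0]
    proof eventually_elim
      case (elim n)
      have "real n * Re \<phi> / 2 \<le> norm (?s n)"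
        using abs_Re_le_norm_sinh[of "of_nat n * \<phi> / 2"] \<phi> by (simp add: abs_mult)
      hence "1 / norm (?s n) \<le> 1 / (real n * Re \<phi> / 2)"
        using elim \<phi> by (intro frac_le) auto
      thus ?case by (simp add: norm_divide field_simps)
    qed
    show "(\<lambda>n. 2 / Re \<phi> * inverse (real n)) \<longlonglongrightarrow> 0"
      by (intro tendsto_mult_right_zero lim_inverse_n)
  qed
  \<comment> \<open>This is coth(w) - 1 = exp(-w) / sinh(w), where exp(-w) is bounded by 1 because
    \<open>Re \<phi> > 0\<close>.\<close>
  have "(\<lambda>n. exp (- (of_nat n * \<phi> / 2)) * (1 / ?s n)) \<longlonglongrightarrow> 0"
  proof (rule Lim_null_comparison)
    show "\<forall>\<^sub>F n in sequentially. norm (exp (- (of_nat n * \<phi> / 2)) * (1 / ?s n)) \<le> norm (1 / ?s n)"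
      using \<phi> by (intro always_eventually allI) (simp add: norm_mult norm_divide divide_right_mono)
    show "(\<lambda>n. norm (1 / ?s n)) \<longlonglongrightarrow> 0" using inv by (rule tendsto_norm_zero)
  qed
  from tendsto_add[OF tendsto_const[of 1] this]
  have coth: "(\<lambda>n. 1 + exp (- (of_nat n * \<phi> / 2)) * (1 / ?s n)) \<longlonglongrightarrow> 1" by simp
  have coth: "(\<lambda>n. ?c n / ?s n) \<longlonglongrightarrow> 1"
  proof (rule Lim_transform_eventually[OF coth])
    show "\<forall>\<^sub>F n in sequentially. 1 + exp (- (of_nat n * \<phi> / 2)) * (1 / ?s n) = ?c n / ?s n"
      using eventually_gt_at_top[of 0]
    proof eventually_elim
      case (elim n)
      have "?c n = ?s n + exp (- (of_nat n * \<phi> / 2))"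
        by (simp add: sinh_field_def cosh_field_def field_simps)
      thus ?case using s[OF elim] by (simp add: field_simps)
    qed
  qed
  show ?thesis
  proof (induction m)
    case 0
    have "(\<lambda>n. - 2 * (?c n / ?s n)) \<longlonglongrightarrow> - 2 * 1" by (intro tendsto_intros coth)
    thus ?case by (simp add: odd_coeff_def)
  next
    case (Suc m)
    have "(\<lambda>n. ?c n / ?s n * (1 / ?s n) ^ (2 * m + 2)) \<longlonglongrightarrow> 1 * 0 ^ (2 * m + 2)"
      by (intro tendsto_intros coth inv)
    moreover have "?c n / ?s n * (1 / ?s n) ^ (2 * m + 2) = ?c n / ?s n ^ (2 * m + 3)" for n
      by (simp add: power_divide power_add eval_nat_numeral)
    ultimately have 1: "(\<lambda>n. ?c n / ?s n ^ (2 * m + 3)) \<longlonglongrightarrow> 0" by simp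
    have "(\<lambda>n. - 2 / of_nat (2 * m + 3) * (?c n / ?s n ^ (2 * m + 3) + of_nat (Suc m) * csch_primitive m (of_nat n * \<phi>)))
       \<longlonglongrightarrow> - 2 / of_nat (2 * m + 3) * (0 + of_nat (Suc m) * ((-1) ^ (m + 1) * odd_coeff m))"
      by (intro tendsto_intros 1 Suc)
    also have "- 2 / of_nat (2 * m + 3) * (0 + of_nat (Suc m) * ((-1) ^ (m + 1) * odd_coeff m))
        = (-1) ^ (Suc m + 1) * odd_coeff (Suc m)"
      unfolding odd_coeff_Suc by (simp add: algebra_simps add_divide_distrib)
    finally show ?case by simp
  qed
qed

section \<open>Laurent expansion at the origin and its regular part\<close>

text \<open>Shifting a power series by \<open>n\<close> amounts to removing the principal part of
  f(x) / x^n; the value at 0 has to be supplied by the n-th coefficient.\<close>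

lemma has_fps_expansion_remainder:
  fixes f :: "complex \<Rightarrow> complex"
  assumes "f has_fps_expansion F"
  shows "(\<lambda>x. if x = 0 then fps_nth F n else (f x - (\<Sum>i<n. fps_nth F i * x ^ i)) / x ^ n)
           has_fps_expansion fps_shift n F"
proof -
  have "eventually (\<lambda>x. x \<in> eball 0 (fps_conv_radius F)) (nhds 0)"
    using assms by (intro eventually_nhds_in_open) (auto simp: has_fps_expansion_def zero_ereal_def)
  moreover have "eventually (\<lambda>x. eval_fps F x = f x) (nhds 0)"
    using assms by (auto simp: has_fps_expansion_def)
  ultimately have "eventually (\<lambda>x. eval_fps (fps_shift n F) x =
      (if x = 0 then fps_nth F n else (f x - (\<Sum>i<n. fps_nth F i * x ^ i)) / x ^ n)) (nhds 0)"
  proof eventually_elim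
    case (elim x)
    show ?case
    proof (cases "x = 0")
      case False
      have "summable (\<lambda>i. fps_nth F i * x ^ i)" using elim by (intro summable_fps) auto
      from suminf_split_initial_segment[OF this, of n]
      have "eval_fps F x = (\<Sum>i. fps_nth (fps_shift n F) i * x ^ i * x ^ n) + (\<Sum>i<n. fps_nth F i * x ^ i)"
        by (simp add: eval_fps_def power_add mult_ac)
      also have "(\<Sum>i. fps_nth (fps_shift n F) i * x ^ i * x ^ n) = eval_fps (fps_shift n F) x * x ^ n"
        unfolding eval_fps_def using elim by (intro suminf_mult2[symmetric] summable_fps) auto
      finally show ?thesis using elim False by (simp add: field_simps)
    qed (simp add: eval_fps_at_0)
  qed
  with assms show ?thesis by (auto simp: has_fps_expansion_def)
qed


text \<open>The Taylor coefficients at 0 of (z / sinh(z/2))^(2m+2). The argument m + 1 is half the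
  exponent: it comes from sinh(z/2) = exp(-z/2) (exp(z) - 1) / 2.\<close>

definition csch_coeff :: "nat \<Rightarrow> nat \<Rightarrow> complex" where
  "csch_coeff m n = 2 ^ (2 * m + 2) * (gen_bernpoly (2 * m + 2) n (of_nat (m + 1)) / fact n)"

lemma csch_power_fps_expansion:
  "(\<lambda>z. if z = 0 then 2 ^ (2 * m + 2) else z ^ (2 * m + 2) / sinh (z / 2) ^ (2 * m + 2))
     has_fps_expansion Abs_fps (csch_coeff m)"
proof -
  let ?B = "\<lambda>z::complex. if z = 0 then 1 else z / (exp z - 1)"
  have "(\<lambda>z. 2 ^ (2 * m + 2) * (?B z ^ (2 * m + 2) * exp (of_nat (m + 1) * z))) has_fps_expansion
      fps_const (2 ^ (2 * m + 2)) * (bernoulli_fps ^ (2 * m + 2) * fps_exp (of_nat (m + 1)))"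
    by (intro fps_expansion_intros bernoulli_fps_expansion)
  also have "(\<lambda>z. 2 ^ (2 * m + 2) * (?B z ^ (2 * m + 2) * exp (of_nat (m + 1) * z)))
      = (\<lambda>z. if z = 0 then 2 ^ (2 * m + 2) else z ^ (2 * m + 2) / sinh (z / 2) ^ (2 * m + 2))"
  proof
    fix z :: complex
    have "sinh (z / 2) = (exp z - 1) / (2 * exp (z / 2))"
    proof -
      have "exp z = exp (z / 2) * exp (z / 2)" by (simp add: exp_add[symmetric])
      thus ?thesis by (simp add: sinh_field_def exp_minus field_simps)
    qed
    hence "z / sinh (z / 2) = 2 * (z / (exp z - 1)) * exp (z / 2)" by (simp add: mult_ac)
    hence "(z / sinh (z / 2)) ^ (2 * m + 2) = 2 ^ (2 * m + 2) * ((z / (exp z - 1)) ^ (2 * m + 2) * exp (z / 2) ^ (2 * m + 2))"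
      by (simp only: power_mult_distrib mult.assoc)
    also have "exp (z / 2) ^ (2 * m + 2) = exp (of_nat (m + 1) * z)"
      unfolding exp_of_nat_mult[symmetric] by (rule arg_cong[where f = exp]) (simp add: field_simps)
    finally have eq: "(z / sinh (z / 2)) ^ (2 * m + 2) = 2 ^ (2 * m + 2) * ((z / (exp z - 1)) ^ (2 * m + 2) * exp (of_nat (m + 1) * z))" .
    show "2 ^ (2 * m + 2) * (?B z ^ (2 * m + 2) * exp (of_nat (m + 1) * z))
        = (if z = 0 then 2 ^ (2 * m + 2) else z ^ (2 * m + 2) / sinh (z / 2) ^ (2 * m + 2))"
    proof (cases "z = 0")
      case False
      thus ?thesis using eq by (simp only: power_divide if_False simp_thms)
    qed simp
  qed
  also have "fps_const (2 ^ (2 * m + 2)) * (bernoulli_fps ^ (2 * m + 2) * fps_exp (of_nat (m + 1))) = Abs_fps (csch_coeff m)"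
    by (rule fps_ext) (simp add: csch_coeff_def gen_bernpoly_def)
  finally show ?thesis .
qed

text \<open>The generating function is even, and expansions are unique. Hence the principal part
  contains even powers only.\<close>

lemma csch_coeff_odd:
  assumes "odd n"
  shows "csch_coeff m n = 0"
proof -
  let ?g = "\<lambda>z. if z = 0 then 2 ^ (2 * m + 2) else z ^ (2 * m + 2) / sinh (z / 2) ^ (2 * m + 2) :: complex"
  have "(?g \<circ> (\<lambda>z. (-1) * z)) has_fps_expansion
          fps_compose (Abs_fps (csch_coeff m)) (fps_const (-1) * fps_X)"
    by (intro has_fps_expansion_compose csch_power_fps_expansion fps_expansion_intros) auto
  also have "?g \<circ> (\<lambda>z. (-1) * z) = ?g" by (auto simp: fun_eq_iff power_minus_even)
  finally have "fps_compose (Abs_fps (csch_coeff m)) (fps_const (-1) * fps_X) = Abs_fps (csch_coeff m)"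
    using csch_power_fps_expansion by (rule fps_expansion_unique_complex)
  hence "fps_nth (fps_compose (Abs_fps (csch_coeff m)) (fps_const (-1) * fps_X)) n = csch_coeff m n"
    by simp
  hence "(-1) ^ n * csch_coeff m n = csch_coeff m n" unfolding fps_compose_linear by simp
  thus ?thesis using assms by simp
qed

text \<open>The power 1 / sinh(z/2)^(2m+2) minus its principal part at 0. The value at 0 is the
  constant Laurent coefficient, which makes the singularity removable.\<close>

definition csch_regular :: "nat \<Rightarrow> complex \<Rightarrow> complex" where
  "csch_regular m z = (if z = 0 then csch_coeff m (2 * m + 2) else
     1 / sinh (z / 2) ^ (2 * m + 2) - (\<Sum>k=1..m+1. csch_coeff m (2 * m + 2 - 2 * k) / z ^ (2 * k)))"

lemma csch_regular_even: "csch_regular m (- z) = csch_regular m z"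
  by (simp add: csch_regular_def power_minus_even)

lemma csch_regular_fps_expansion:
  "csch_regular m has_fps_expansion fps_shift (2 * m + 2) (Abs_fps (csch_coeff m))"
proof -
  let ?N = "2 * m + 2"
  have "(\<Sum>i<?N. csch_coeff m i * x ^ i) / x ^ ?N = (\<Sum>k=1..m+1. csch_coeff m (?N - 2 * k) / x ^ (2 * k))"
    if x: "x \<noteq> 0" for x
  proof -
    \<comment> \<open>The indices \<open>?N - 2 * k\<close> are exactly the even ones below
      \<open>?N\<close>; the odd ones contribute 0.\<close>
    have "(\<Sum>i<?N. csch_coeff m i * x ^ i) = (\<Sum>i\<in>(\<lambda>k. ?N - 2 * k) ` {1..m+1}. csch_coeff m i * x ^ i)"
    proof (rule sum.mono_neutral_right)
      show "\<forall>i\<in>{..<?N} - (\<lambda>k. ?N - 2 * k) ` {1..m+1}. csch_coeff m i * x ^ i = 0"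
      proof
        fix i assume i: "i \<in> {..<?N} - (\<lambda>k. ?N - 2 * k) ` {1..m+1}"
        have "odd i"
        proof
          assume "even i"
          then obtain j where "i = 2 * j" by blast
          hence "i = ?N - 2 * (m + 1 - j)" "m + 1 - j \<in> {1..m+1}" using i by auto
          thus False using i by blast
        qed
        thus "csch_coeff m i * x ^ i = 0" by (simp add: csch_coeff_odd)
      qed
    qed auto
    also have "\<dots> = (\<Sum>k=1..m+1. csch_coeff m (?N - 2 * k) * x ^ (?N - 2 * k))"
      by (subst sum.reindex) (auto simp: inj_on_def)
    finally have 1: "(\<Sum>i<?N. csch_coeff m i * x ^ i) = (\<Sum>k=1..m+1. csch_coeff m (?N - 2 * k) * x ^ (?N - 2 * k))" .
    show ?thesis
      unfolding 1 sum_divide_distrib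
    proof (rule sum.cong[OF refl])
      fix k assume k: "k \<in> {1..m+1}"
      have "x ^ ?N = x ^ (?N - 2 * k) * x ^ (2 * k)"
        using k by (simp add: power_add[symmetric] del: power_Suc)
      thus "csch_coeff m (?N - 2 * k) * x ^ (?N - 2 * k) / x ^ ?N = csch_coeff m (?N - 2 * k) / x ^ (2 * k)"
        using x by simp
    qed
  qed
  hence "csch_regular m = (\<lambda>x. if x = 0 then fps_nth (Abs_fps (csch_coeff m)) ?N
      else ((if x = 0 then 2 ^ ?N else x ^ ?N / sinh (x / 2) ^ ?N) -
        (\<Sum>i<?N. fps_nth (Abs_fps (csch_coeff m)) i * x ^ i)) / x ^ ?N)"
    by (auto simp: fun_eq_iff csch_regular_def diff_divide_distrib simp del: power_Suc)
  thus ?thesis using has_fps_expansion_remainder[OF csch_power_fps_expansion, of m ?N] by (simp only:)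
qed

lemma csch_regular_holomorphic: "csch_regular m holomorphic_on slit_domain"
proof -
  have "(\<lambda>z. 1 / sinh (z / 2) ^ (2 * m + 2) - (\<Sum>k=1..m+1. csch_coeff m (2 * m + 2 - 2 * k) / z ^ (2 * k)))
          holomorphic_on (slit_domain - {0})"
    unfolding sinh_field_def
    by (intro holomorphic_intros) (use sinh_half_nonzero in \<open>auto simp: sinh_field_def\<close>)
  hence h: "csch_regular m holomorphic_on (slit_domain - {0})"
    by (rule holomorphic_transform) (auto simp: csch_regular_def)
  have "csch_regular m field_differentiable at z" if z: "z \<in> slit_domain" for z
  proof (cases "z = 0")
    case True
    have "csch_regular m analytic_on {0}"
      using csch_regular_fps_expansion by (rule has_fps_expansion_imp_analytic_0)
    thus ?thesis unfolding True by (rule analytic_on_imp_differentiable_at) simp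
  next
    case False
    thus ?thesis using z slit_domain(1) by (intro holomorphic_on_imp_differentiable_at[OF h]) auto
  qed
  thus ?thesis by (auto simp: holomorphic_on_def field_differentiable_at_within)
qed

text \<open>The constant of integration vanishes because both sides of the equation are odd.\<close>

lemma csch_regular_primitive:
  obtains F where
    "\<And>z. z \<in> slit_domain \<Longrightarrow> (F has_field_derivative csch_regular m z) (at z)"
    "\<And>z. z \<in> slit_domain \<Longrightarrow> z \<noteq> 0 \<Longrightarrow> F z = csch_primitive m z +
       (\<Sum>k=1..m+1. csch_coeff m (2 * m + 2 - 2 * k) / (of_nat (2 * k - 1) * z ^ (2 * k - 1)))"
proof -
  let ?b = "\<lambda>k. csch_coeff m (2 * m + 2 - 2 * k)"
  define E where "E = (\<lambda>z. csch_primitive m z + (\<Sum>k=1..m+1. ?b k / (of_nat (2 * k - 1) * z ^ (2 * k - 1))))"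
  obtain G where G: "\<And>z. z \<in> slit_domain \<Longrightarrow> (G has_field_derivative csch_regular m z) (at z)"
    using holomorphic_starlike_primitive[of slit_domain "csch_regular m" "{}"]
      csch_regular_holomorphic[of m] starlike_slit_domain slit_domain(1)
    by (metis Diff_empty finite.emptyI holomorphic_on_imp_continuous_on holomorphic_on_imp_differentiable_at)
  \<comment> \<open>The odd part of \<open>G\<close> is still a primitive, because
    \<open>csch_regular m\<close> is even.\<close>
  define F where "F = (\<lambda>z. (G z - G (- z)) / 2)"
  have F: "(F has_field_derivative csch_regular m z) (at z)" if z: "z \<in> slit_domain" for z
  proof -
    have "- z \<in> slit_domain" using z slit_domain(3) by blast
    have "((\<lambda>z. G (- z)) has_field_derivative csch_regular m (- z) * (- 1)) (at z)"
      by (rule DERIV_chain2[where f = G and g = uminus, OF G]) (auto intro!: derivative_eq_intros \<open>- z \<in> slit_domain\<close>)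
    hence "((\<lambda>z. G (- z)) has_field_derivative - csch_regular m z) (at z)"
      by (simp add: csch_regular_even)
    from DERIV_cdivide[OF DERIV_diff[OF G[OF z] this], of 2] show ?thesis
      by (simp add: F_def)
  qed
  have E: "(E has_field_derivative csch_regular m z) (at z)" if z: "z \<in> slit_domain" "z \<noteq> 0" for z
  proof -
    have "((\<lambda>z. ?b k / (of_nat (2 * k - 1) * z ^ (2 * k - 1))) has_field_derivative - (?b k / z ^ (2 * k))) (at z)"
      if k: "k \<in> {1..m+1}" for k
    proof -
      obtain j where j: "k = Suc j" using k by (cases k) auto
      define N :: complex where "N = of_nat (2 * j + 1)"
      have N: "N \<noteq> 0" unfolding N_def by (simp only: of_nat_eq_0_iff)
      have pd: "((\<lambda>z. z ^ (2 * j + 1)) has_field_derivative N * z ^ (2 * j)) (at z)"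
        by (rule DERIV_cong[OF DERIV_power[OF DERIV_ident]]) (simp add: N_def)
      have "((\<lambda>z. ?b k / (N * z ^ (2 * j + 1))) has_field_derivative
          (0 * (N * z ^ (2 * j + 1)) - ?b k * (N * (N * z ^ (2 * j)))) / ((N * z ^ (2 * j + 1)) * (N * z ^ (2 * j + 1)))) (at z)"
        using z N by (intro DERIV_divide DERIV_cmult DERIV_const pd) simp_all
      also have "(0 * (N * z ^ (2 * j + 1)) - ?b k * (N * (N * z ^ (2 * j)))) / ((N * z ^ (2 * j + 1)) * (N * z ^ (2 * j + 1)))
          = - (?b k / z ^ (2 * k))"
        using z N unfolding j by (simp add: field_simps power_add)
      finally show ?thesis by (simp add: j N_def)
    qed
    hence "((\<lambda>z. \<Sum>k=1..m+1. ?b k / (of_nat (2 * k - 1) * z ^ (2 * k - 1))) has_field_derivative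
        (\<Sum>k=1..m+1. - (?b k / z ^ (2 * k)))) (at z)" by (rule DERIV_sum)
    from DERIV_add[OF csch_primitive_derivative[OF sinh_half_nonzero[OF z], of m] this]
    have "(E has_field_derivative 1 / sinh (z / 2) ^ (2 * m + 2) + (\<Sum>k=1..m+1. - (?b k / z ^ (2 * k)))) (at z)"
      unfolding E_def .
    thus ?thesis using z by (simp only: csch_regular_def sum_negf if_False diff_conv_add_uminus)
  qed
  \<comment> \<open>The gap between the two slits joins the half-planes around 0, so a single
    constant serves both, and comparing the values at 1 and -1 determines it.\<close>
  have "connected (slit_domain - {0})"
    using slit_domain(1) starlike_imp_connected[OF starlike_slit_domain]
    by (intro connected_open_delete) auto
  moreover have "((\<lambda>z. F z - E z) has_field_derivative 0) (at z)" if "z \<in> slit_domain - {0}" for z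
    using DERIV_diff[OF F E, of z] that by simp
  ultimately have "(\<lambda>z. F z - E z) constant_on (slit_domain - {0})"
    using slit_domain(1) by (intro has_field_derivative_0_imp_constant_on) auto
  then obtain c where c: "\<And>z. z \<in> slit_domain \<Longrightarrow> z \<noteq> 0 \<Longrightarrow> F z - E z = c"
    unfolding constant_on_def by auto
  have "(\<Sum>k=1..m+1. ?b k / (of_nat (2 * k - 1) * (-1) ^ (2 * k - 1)))
      = - (\<Sum>k=1..m+1. ?b k / (of_nat (2 * k - 1) * 1 ^ (2 * k - 1)))"
    unfolding sum_negf[symmetric]
  proof (intro sum.cong refl)
    fix k assume "k \<in> {1..m+1}"
    hence "odd (2 * k - 1)" by simp
    hence "(-1) ^ (2 * k - 1) = (-1 :: complex)" by simp
    thus "?b k / (of_nat (2 * k - 1) * (-1) ^ (2 * k - 1)) = - (?b k / (of_nat (2 * k - 1) * 1 ^ (2 * k - 1)))"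
      by (simp only: power_one mult_minus_right mult_1_right divide_minus_right)
  qed
  hence "E (- 1) = - E 1"
    by (simp only: E_def csch_primitive_odd minus_add_distrib)
  moreover have "F (- 1) = - F 1" by (simp add: F_def minus_divide_left)
  moreover have "F 1 - E 1 = c" "F (- 1) - E (- 1) = c" by (intro c; simp add: slit_domain_def)+
  ultimately have "c = - c" by (metis minus_diff_commute minus_diff_eq minus_diff_minus)
  hence "c = 0" by simp
  show ?thesis
    by (rule that[of F]) (use F c \<open>c = 0\<close> in \<open>auto simp: E_def\<close>)
qed

section \<open>Decay in sectors\<close>

text \<open>Near 0 compactness gives a bound, since the radius 2 is below 2 pi; in the sector the
  linear lower bound on sinh does. The disc is included because small circles around sector points
  near the apex leave every sector.\<close>

lemma csch_regular_decay:
  assumes \<epsilon>: "0 < \<epsilon>"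
  obtains C where "\<And>w. norm w \<le> 2 \<or> \<epsilon> * norm w \<le> \<bar>Re w\<bar> \<Longrightarrow> norm (csch_regular m w) \<le> C / (1 + (norm w)\<^sup>2)"
proof -
  let ?b = "\<lambda>k. csch_coeff m (2 * m + 2 - 2 * k)"
  have "cball 0 2 \<subseteq> slit_domain"
  proof
    fix z :: complex assume "z \<in> cball 0 2"
    hence "\<bar>Im z\<bar> \<le> 2" using abs_Im_le_cmod[of z] by simp
    thus "z \<in> slit_domain" using pi_gt3 by (simp add: slit_domain_def)
  qed
  hence "continuous_on (cball 0 2) (csch_regular m)"
    using csch_regular_holomorphic holomorphic_on_imp_continuous_on continuous_on_subset by blast
  hence "bounded (csch_regular m ` cball 0 2)"
    by (intro compact_imp_bounded compact_continuous_image) auto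
  then obtain M where "\<forall>w\<in>cball 0 2. norm (csch_regular m w) \<le> M"
    unfolding bounded_iff by auto
  hence M: "norm (csch_regular m w) \<le> M" if "norm w \<le> 2" for w using that by simp
  have "M \<ge> 0" using M[of 0] norm_ge_zero order_trans by (metis norm_zero zero_le_numeral)
  define K where "K = (2 / \<epsilon>) ^ (2 * m + 2) + (\<Sum>k=1..m+1. norm (?b k))"
  have K: "K \<ge> 0" using \<epsilon> by (simp add: K_def sum_nonneg)
  have far: "norm (csch_regular m w) \<le> K / (norm w)\<^sup>2" if w: "1 \<le> norm w" "\<epsilon> * norm w \<le> \<bar>Re w\<bar>" for w
  proof -
    have w0: "w \<noteq> 0" using w by auto
    have sq: "(norm w)\<^sup>2 \<le> norm w ^ n" if "n \<ge> 2" for n using w that by (intro power_increasing) auto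
    have pos: "0 < \<epsilon> * norm w / 2" using \<epsilon> w0 by simp
    have "\<epsilon> * norm w / 2 \<le> norm (sinh (w / 2))" using abs_Re_le_norm_sinh[of "w / 2"] w by simp
    hence "1 / norm (sinh (w / 2)) ^ (2 * m + 2) \<le> 1 / (\<epsilon> * norm w / 2) ^ (2 * m + 2)"
      using pos by (intro frac_le power_mono zero_less_power) auto
    also have "\<dots> = (2 / \<epsilon>) ^ (2 * m + 2) / norm w ^ (2 * m + 2)"
      by (simp only: power_divide power_mult_distrib) simp
    also have "\<dots> \<le> (2 / \<epsilon>) ^ (2 * m + 2) / (norm w)\<^sup>2"
      using \<epsilon> w0 by (intro divide_left_mono sq) auto
    finally have 1: "norm (1 / sinh (w / 2) ^ (2 * m + 2)) \<le> (2 / \<epsilon>) ^ (2 * m + 2) / (norm w)\<^sup>2"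
      by (simp only: norm_divide norm_power norm_one)
    have "norm (\<Sum>k=1..m+1. ?b k / w ^ (2 * k)) \<le> (\<Sum>k=1..m+1. norm (?b k) / (norm w)\<^sup>2)"
    proof (rule sum_norm_le)
      fix k assume "k \<in> {1..m+1}"
      thus "norm (?b k / w ^ (2 * k)) \<le> norm (?b k) / (norm w)\<^sup>2"
        unfolding norm_divide norm_power using w0 by (intro divide_left_mono sq) auto
    qed
    also have "\<dots> = (\<Sum>k=1..m+1. norm (?b k)) / (norm w)\<^sup>2" by (rule sum_divide_distrib[symmetric])
    finally have 2: "norm (\<Sum>k=1..m+1. ?b k / w ^ (2 * k)) \<le> (\<Sum>k=1..m+1. norm (?b k)) / (norm w)\<^sup>2" .
    have "norm (1 / sinh (w / 2) ^ (2 * m + 2) - (\<Sum>k=1..m+1. ?b k / w ^ (2 * k)))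
        \<le> (2 / \<epsilon>) ^ (2 * m + 2) / (norm w)\<^sup>2 + (\<Sum>k=1..m+1. norm (?b k)) / (norm w)\<^sup>2"
      by (rule order_trans[OF norm_triangle_ineq4 add_mono[OF 1 2]])
    thus ?thesis using w0 unfolding csch_regular_def K_def add_divide_distrib by (simp only: if_False)
  qed
  show ?thesis
  proof (rule that)
    fix w assume w: "norm w \<le> 2 \<or> \<epsilon> * norm w \<le> \<bar>Re w\<bar>"
    \<comment> \<open>The 5 is the largest value of \<open>1 + (norm w)\<^sup>2\<close> on the disc,
      and the 2 comes from \<open>1 + (norm w)\<^sup>2 \<le> 2 * (norm w)\<^sup>2\<close> outside
      it.\<close>
    show "norm (csch_regular m w) \<le> (5 * M + 2 * K) / (1 + (norm w)\<^sup>2)"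
    proof (cases "norm w \<le> 2")
      case True
      have "(norm w)\<^sup>2 \<le> 2\<^sup>2" using True by (intro power_mono) auto
      hence "M * (1 + (norm w)\<^sup>2) \<le> M * 5" using \<open>M \<ge> 0\<close> by (intro mult_left_mono) auto
      hence "M \<le> (5 * M + 2 * K) / (1 + (norm w)\<^sup>2)"
        using K by (subst pos_le_divide_eq) (auto simp: add_pos_nonneg)
      thus ?thesis using M[OF True] by simp
    next
      case False
      hence sq: "1 \<le> (norm w)\<^sup>2" by (intro one_le_power) auto
      have "norm (csch_regular m w) \<le> K / (norm w)\<^sup>2" using w False by (intro far) auto
      also have "\<dots> = 2 * K / (2 * (norm w)\<^sup>2)" by simp
      also have "\<dots> \<le> 2 * K / (1 + (norm w)\<^sup>2)"
        using K sq by (intro divide_left_mono mult_pos_pos) (auto simp: add_pos_nonneg)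
      also have "\<dots> \<le> (5 * M + 2 * K) / (1 + (norm w)\<^sup>2)"
        using \<open>M \<ge> 0\<close> by (intro divide_right_mono) auto
      finally show ?thesis .
    qed
  qed
qed

text \<open>Cauchy's inequality on circles whose radius does not depend on \<open>z\<close>: they
  stay in the sector of parameter \<open>\<epsilon> / 2\<close> or in the disc, where the function
  itself is already bounded.\<close>

lemma csch_regular_higher_deriv_decay:
  assumes \<epsilon>: "0 < \<epsilon>" "\<epsilon> \<le> 1"
  obtains C where "\<And>z. \<epsilon> * norm z \<le> \<bar>Re z\<bar> \<Longrightarrow>
    norm ((deriv ^^ i) (csch_regular m) z) \<le> C / (1 + (norm z)\<^sup>2)"
proof -
  from \<epsilon> have "0 < \<epsilon> / 2" by simp
  then obtain C where C: "\<And>w. norm w \<le> 2 \<or> \<epsilon> / 2 * norm w \<le> \<bar>Re w\<bar> \<Longrightarrow>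
      norm (csch_regular m w) \<le> C / (1 + (norm w)\<^sup>2)" using csch_regular_decay by metis
  have "norm (csch_regular m 0) \<le> C" using C[of 0] by simp
  hence C0: "C \<ge> 0" using norm_ge_zero order_trans by blast
  \<comment> \<open>With \<open>2 * r = \<epsilon> / 2\<close>, a point within \<open>r\<close> of
    the sector but outside the wider one has norm at most 1.\<close>
  define r where "r = \<epsilon> / 4"
  have r: "0 < r" "r \<le> 1 / 4" using \<epsilon> by (auto simp: r_def)
  show ?thesis
  proof (rule that)
    fix z assume z: "\<epsilon> * norm z \<le> \<bar>Re z\<bar>"
    have near: "norm w \<le> 2 \<or> \<epsilon> / 2 * norm w \<le> \<bar>Re w\<bar>" if w: "norm (z - w) \<le> r" for w
    proof (rule disjCI)
      assume "\<not> \<epsilon> / 2 * norm w \<le> \<bar>Re w\<bar>"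
      moreover have "\<bar>Re z\<bar> \<le> \<bar>Re w\<bar> + r" using abs_Re_le_cmod[of "z - w"] w by simp
      moreover have "norm w \<le> norm z + r" using norm_triangle_sub[of w z] w by (simp add: norm_minus_commute)
      hence "\<epsilon> * norm w \<le> \<epsilon> * norm z + \<epsilon> * r" using \<epsilon> by (simp add: distrib_left[symmetric])
      moreover have "\<epsilon> * r \<le> r" using \<epsilon> r by simp
      ultimately have "\<epsilon> / 2 * norm w \<le> \<epsilon> / 2 * 1" using z by (simp add: r_def)
      hence "norm w \<le> 1" using \<epsilon> by simp
      thus "norm w \<le> 2" by simp
    qed
    have sub: "cball z r \<subseteq> slit_domain"
    proof
      fix w assume "w \<in> cball z r"
      hence "norm w \<le> 2 \<or> \<epsilon> / 2 * norm w \<le> \<bar>Re w\<bar>" by (intro near) (simp add: dist_norm)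
      thus "w \<in> slit_domain"
      proof
        assume "norm w \<le> 2"
        hence "\<bar>Im w\<bar> \<le> 2" using abs_Im_le_cmod[of w] by simp
        thus ?thesis using pi_gt3 by (simp add: slit_domain_def)
      next
        assume *: "\<epsilon> / 2 * norm w \<le> \<bar>Re w\<bar>"
        show ?thesis
        proof (cases "w = 0")
          case False
          hence "0 < \<epsilon> / 2 * norm w" using \<epsilon> by simp
          hence "Re w \<noteq> 0" using * by auto
          thus ?thesis by (simp add: slit_domain_def)
        qed (simp add: slit_domain)
      qed
    qed
    have "norm ((deriv ^^ i) (csch_regular m) z) \<le> fact i * (2 * C / (1 + (norm z)\<^sup>2)) / r ^ i"
    proof (rule Cauchy_inequality)
      show "csch_regular m holomorphic_on ball z r"
        using csch_regular_holomorphic sub ball_subset_cball holomorphic_on_subset by blast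
      show "continuous_on (cball z r) (csch_regular m)"
        using csch_regular_holomorphic sub holomorphic_on_imp_continuous_on continuous_on_subset by blast
      fix w assume w: "norm (z - w) = r"
      \<comment> \<open>The weight \<open>1 + (norm z)\<^sup>2\<close> exceeds its value on the
        circle at most by the factor 2.\<close>
      have "norm z \<le> norm w + r" using norm_triangle_sub[of z w] w by simp
      hence "(norm z)\<^sup>2 \<le> (norm w + 1 / 4)\<^sup>2" using r by (intro power_mono) auto
      also have "\<dots> \<le> 1 + 2 * (norm w)\<^sup>2"
        using zero_le_power2[of "norm w - 1 / 4"] by (simp add: power2_eq_square algebra_simps)
      finally have "1 + (norm z)\<^sup>2 \<le> 2 * (1 + (norm w)\<^sup>2)" by simp
      hence "2 * C / (2 * (1 + (norm w)\<^sup>2)) \<le> 2 * C / (1 + (norm z)\<^sup>2)"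
        using C0 by (intro divide_left_mono mult_pos_pos) (auto simp: add_pos_nonneg)
      moreover have "norm (csch_regular m w) \<le> C / (1 + (norm w)\<^sup>2)" by (intro C near) (simp add: w)
      ultimately show "norm (csch_regular m w) \<le> 2 * C / (1 + (norm z)\<^sup>2)"
        by (simp only: mult_divide_mult_cancel_left_if) simp
    qed (fact r)
    thus "norm ((deriv ^^ i) (csch_regular m) z) \<le> fact i * (2 * C) / r ^ i / (1 + (norm z)\<^sup>2)"
      by (simp add: mult_ac)
  qed
qed

section \<open>From the series to the two-sided sum\<close>

lemma bernoulli_fps_nth_0: "fps_nth bernoulli_fps 0 = 1"
  using fps_nth_fps_expansion[OF bernoulli_fps_expansion, of 0] by simp

text \<open>Writing 2^(2m+1) as 2^(2m+2) / 2 turns the Bernoulli factor into zeta(2k) for k >= 1, as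
  in \<open>even_zeta_sums\<close>, and into -1/2 for k = 0.\<close>

lemma poly_calB_csch_coeff:
  "poly (calB m) \<phi> = (\<Sum>k\<le>m+1. csch_coeff m (2 * m + 2 - 2 * k) *
     (- ((2 * of_real pi * \<i>) ^ (2 * k) * (bernoulli_num (2 * k) / fact (2 * k))) / 2) * \<phi> ^ (2 * m + 2 - 2 * k))"
  unfolding poly_calB sum_distrib_left csch_coeff_def
  by (intro sum.cong refl) (simp add: mult_ac)

lemma poly_calB_even: "poly (calB m) (- \<phi>) = poly (calB m) \<phi>"
  unfolding poly_calB by (simp add: power_minus_even)

lemma S_fun_even: "S_fun m (- \<phi>) = S_fun m \<phi>"
  unfolding S_fun_def by (simp add: power_minus_even)

text \<open>An exact identity: every power of the principal part sums to an even zeta value, and the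
  rest is half of a sum over all integers, by evenness. All asymptotics is thus confined to
  \<open>two_sided_sum\<close>.\<close>

lemma S_fun_two_sided_sum:
  assumes \<phi>: "Re \<phi> \<noteq> 0"
    and summable: "summable (\<lambda>n. csch_regular m (of_nat n * \<phi>) + csch_regular m (- (of_nat (Suc n) * \<phi>)))"
  shows "S_fun m \<phi> = poly (calB m) \<phi> + \<phi> ^ (2 * m + 2) * two_sided_sum (csch_regular m) \<phi> / 2"
proof -
  let ?N = "2 * m + 2" and ?f = "csch_regular m" and ?b = "\<lambda>k. csch_coeff m (2 * m + 2 - 2 * k)"
  let ?z = "\<lambda>k. - ((2 * of_real pi * \<i>) ^ (2 * k) * (bernoulli_num (2 * k) / fact (2 * k))) / 2 :: complex"
  have \<phi>0: "\<phi> \<noteq> 0" using \<phi> by auto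
  have "(\<lambda>n. \<phi> ^ ?N / sinh (of_nat (Suc n) * \<phi> / 2) ^ ?N
          - (\<Sum>k=1..m+1. ?b k * \<phi> ^ (?N - 2 * k) * (1 / of_nat (Suc n) ^ (2 * k))))
        sums (S_fun m \<phi> - (\<Sum>k=1..m+1. ?b k * \<phi> ^ (?N - 2 * k) * ?z k))"
    unfolding S_fun_def
    by (intro sums_diff sums_sum sums_mult even_zeta_sums summable_sums S_fun_summable \<phi>) auto
  also have "(\<lambda>n. \<phi> ^ ?N / sinh (of_nat (Suc n) * \<phi> / 2) ^ ?N
          - (\<Sum>k=1..m+1. ?b k * \<phi> ^ (?N - 2 * k) * (1 / of_nat (Suc n) ^ (2 * k))))
      = (\<lambda>n. \<phi> ^ ?N * ?f (of_nat (Suc n) * \<phi>))"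
  proof
    fix n
    have "(\<Sum>k=1..m+1. ?b k * \<phi> ^ (?N - 2 * k) * (1 / of_nat (Suc n) ^ (2 * k)))
        = \<phi> ^ ?N * (\<Sum>k=1..m+1. ?b k / (of_nat (Suc n) * \<phi>) ^ (2 * k))"
      unfolding sum_distrib_left
    proof (intro sum.cong refl)
      fix k assume k: "k \<in> {1..m+1}"
      have "\<phi> ^ ?N = \<phi> ^ (?N - 2 * k) * \<phi> ^ (2 * k)"
        using k by (simp add: power_add[symmetric] del: power_Suc)
      thus "?b k * \<phi> ^ (?N - 2 * k) * (1 / of_nat (Suc n) ^ (2 * k)) = \<phi> ^ ?N * (?b k / (of_nat (Suc n) * \<phi>) ^ (2 * k))"
        using \<phi>0 by (simp add: power_mult_distrib del: of_nat_Suc)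
    qed
    thus "\<phi> ^ ?N / sinh (of_nat (Suc n) * \<phi> / 2) ^ ?N
          - (\<Sum>k=1..m+1. ?b k * \<phi> ^ (?N - 2 * k) * (1 / of_nat (Suc n) ^ (2 * k)))
        = \<phi> ^ ?N * ?f (of_nat (Suc n) * \<phi>)"
      using \<phi>0 unfolding csch_regular_def
      by (simp add: right_diff_distrib del: of_nat_Suc power_Suc sum.cl_ivl_Suc)
  qed
  finally have "(\<lambda>n. \<phi> ^ ?N * ?f (of_nat (Suc n) * \<phi>)) sums (S_fun m \<phi> - (\<Sum>k=1..m+1. ?b k * \<phi> ^ (?N - 2 * k) * ?z k))" .
  moreover have "(\<Sum>k=1..m+1. ?b k * \<phi> ^ (?N - 2 * k) * ?z k) = poly (calB m) \<phi> + ?b 0 * \<phi> ^ ?N / 2"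
  proof -
    have "?z 0 = - 1 / 2" by (simp add: bernoulli_num_def gen_bernpoly_def bernoulli_fps_nth_0)
    thus ?thesis unfolding poly_calB_csch_coeff
      by (simp add: atMost_atLeast0 sum.atLeast_Suc_atMost[of 0] mult_ac del: sum.cl_ivl_Suc power_Suc)
  qed
  ultimately have s1: "(\<lambda>n. \<phi> ^ ?N * ?f (of_nat (Suc n) * \<phi>)) sums (S_fun m \<phi> - (poly (calB m) \<phi> + ?b 0 * \<phi> ^ ?N / 2))"
    by simp
  \<comment> \<open>Adding the sums from n = 0 and from n = 1 counts the value at 0 once; it cancels
    the two halves \<open>?b 0 * \<phi> ^ ?N / 2\<close>.\<close>
  have "(\<lambda>n. \<phi> ^ ?N * ?f (of_nat n * \<phi>)) sums
      (S_fun m \<phi> - (poly (calB m) \<phi> + ?b 0 * \<phi> ^ ?N / 2) + \<phi> ^ ?N * ?f (of_nat 0 * \<phi>))"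
    using s1 by (subst (asm) sums_Suc_iff)
  from sums_add[OF this s1]
  have "(\<lambda>n. \<phi> ^ ?N * (?f (of_nat n * \<phi>) + ?f (- (of_nat (Suc n) * \<phi>)))) sums
      (2 * (S_fun m \<phi> - poly (calB m) \<phi>))"
    by (simp add: csch_regular_even distrib_left csch_regular_def[of m 0] algebra_simps del: of_nat_Suc power_Suc)
  moreover have "(\<lambda>n. \<phi> ^ ?N * (?f (of_nat n * \<phi>) + ?f (- (of_nat (Suc n) * \<phi>)))) sums
      (\<phi> ^ ?N * two_sided_sum ?f \<phi>)"
    unfolding two_sided_sum_def by (intro sums_mult summable_sums summable)
  ultimately have "2 * (S_fun m \<phi> - poly (calB m) \<phi>) = \<phi> ^ ?N * two_sided_sum ?f \<phi>"
    by (rule sums_unique2)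
  thus ?thesis by (simp add: field_simps)
qed

abbreviation (input) right_expansion :: "nat \<Rightarrow> complex poly" where
  "right_expansion m \<equiv> calB m + monom ((-1) ^ (m + 1) * odd_coeff m) (2 * m + 1)"

abbreviation (input) left_expansion :: "nat \<Rightarrow> complex poly" where
  "left_expansion m \<equiv> calB m - monom ((-1) ^ (m + 1) * odd_coeff m) (2 * m + 1)"

text \<open>By the exact identity the remainder is \<open>\<phi> ^ (2 * m + 1) / 2\<close> times the
  error of \<open>\<phi>\<close> times the two-sided sum against its integral \<open>2 * I\<close>,
  and that error is smaller than any power.\<close>

lemma S_fun_right_remainder:
  assumes \<epsilon>: "0 < \<epsilon>" "\<epsilon> \<le> 1"
  shows "\<exists>K. \<forall>\<phi>. \<epsilon> * norm \<phi> \<le> Re \<phi> \<longrightarrow> 0 < norm \<phi> \<longrightarrow> norm \<phi> \<le> 1 \<longrightarrow>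
           norm (S_fun m \<phi> - poly (right_expansion m) \<phi>) \<le> K * norm \<phi> ^ R"
proof -
  define I where "I = (-1) ^ (m + 1) * odd_coeff m"
  let ?f = "csch_regular m" and ?b = "\<lambda>k. csch_coeff m (2 * m + 2 - 2 * k)"
  obtain F where F: "\<And>z. z \<in> slit_domain \<Longrightarrow> (F has_field_derivative ?f z) (at z)"
    and F_eq: "\<And>z. z \<in> slit_domain \<Longrightarrow> z \<noteq> 0 \<Longrightarrow> F z = csch_primitive m z +
       (\<Sum>k=1..m+1. ?b k / (of_nat (2 * k - 1) * z ^ (2 * k - 1)))"
    by (rule csch_regular_primitive[of m]) blast
  define A where "A = (\<lambda>i. case i of 0 \<Rightarrow> F | Suc j \<Rightarrow> (deriv ^^ j) ?f)"
  \<comment> \<open>A double sector, unlike \<open>\<Phi>\<close>: the line through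
    \<open>\<phi>\<close> also runs through the left half-plane.\<close>
  define X where "X = {z. \<epsilon> * norm z \<le> \<bar>Re z\<bar>}"
  define \<Phi> where "\<Phi> = {\<phi>. \<epsilon> * norm \<phi> \<le> Re \<phi>}"
  have X_slit: "z \<in> slit_domain" if "z \<in> X" for z
  proof (cases "z = 0")
    case False
    hence "0 < \<epsilon> * norm z" using \<epsilon> by simp
    hence "Re z \<noteq> 0" using that by (auto simp: X_def)
    thus ?thesis by (simp add: slit_domain_def)
  qed (simp add: slit_domain)
  have deriv: "(A i has_field_derivative A (Suc i) z) (at z)" if "z \<in> X" for i z
    using F[OF X_slit[OF that]] has_field_derivative_higher_deriv[OF csch_regular_holomorphic slit_domain(1) X_slit[OF that]]
    by (cases i) (auto simp: A_def)
  obtain C where C: "\<And>i z. z \<in> X \<Longrightarrow> norm (A (Suc i) z) \<le> C i / (1 + (norm z)\<^sup>2)"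
  proof -
    have "\<forall>i. \<exists>C. \<forall>z. \<epsilon> * norm z \<le> \<bar>Re z\<bar> \<longrightarrow> norm ((deriv ^^ i) ?f z) \<le> C / (1 + (norm z)\<^sup>2)"
      by (rule allI, rule csch_regular_higher_deriv_decay[OF \<epsilon>], blast)
    then obtain C where "\<And>i z. \<epsilon> * norm z \<le> \<bar>Re z\<bar> \<Longrightarrow> norm ((deriv ^^ i) ?f z) \<le> C i / (1 + (norm z)\<^sup>2)"
      by metis
    thus ?thesis by (intro that[of C]) (auto simp: A_def X_def)
  qed
  have ray: "of_real t * \<phi> \<in> X" if "\<phi> \<in> \<Phi>" for t :: real and \<phi>
  proof -
    have "\<bar>t\<bar> * (\<epsilon> * norm \<phi>) \<le> \<bar>t\<bar> * \<bar>Re \<phi>\<bar>" using that by (intro mult_left_mono) (auto simp: \<Phi>_def)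
    thus ?thesis by (simp add: X_def norm_mult abs_mult mult_ac)
  qed
  have pos: "Re \<phi> > 0" if "\<phi> \<in> \<Phi>" "\<phi> \<noteq> 0" for \<phi>
  proof -
    have "0 < \<epsilon> * norm \<phi>" using \<epsilon> that by simp
    thus ?thesis using that by (simp add: \<Phi>_def)
  qed
  \<comment> \<open>The negative powers in \<open>F\<close> vanish at infinity, so \<open>F\<close>
    has the limit \<open>I\<close> of \<open>csch_primitive m\<close>; oddness doubles it.\<close>
  have lim: "(\<lambda>n. A 0 (of_nat n * \<phi>) - A 0 (- (of_nat n * \<phi>))) \<longlonglongrightarrow> 2 * I" if \<phi>: "\<phi> \<in> \<Phi>" "\<phi> \<noteq> 0" for \<phi>
  proof -
    have "(\<lambda>n. \<Sum>k=1..m+1. ?b k / (of_nat (2 * k - 1) * (of_nat n * \<phi>) ^ (2 * k - 1))) \<longlonglongrightarrow> (\<Sum>k=1..m+1. 0)"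
    proof (rule tendsto_sum)
      fix k assume k: "k \<in> {1..m+1}"
      have "(\<lambda>n. ?b k / (of_nat (2 * k - 1) * \<phi> ^ (2 * k - 1)) * (1 / of_nat n) ^ (2 * k - 1))
          \<longlonglongrightarrow> ?b k / (of_nat (2 * k - 1) * \<phi> ^ (2 * k - 1)) * 0 ^ (2 * k - 1)"
        by (intro tendsto_intros lim_1_over_n)
      moreover have "(0::complex) ^ (2 * k - 1) = 0" using k by (intro zero_power) auto
      ultimately show "(\<lambda>n. ?b k / (of_nat (2 * k - 1) * (of_nat n * \<phi>) ^ (2 * k - 1))) \<longlonglongrightarrow> 0"
        by (simp add: power_mult_distrib power_divide mult_ac del: of_nat_diff power_eq_0_iff)
    qed
    from tendsto_add[OF csch_primitive_limit[OF pos[OF \<phi>], of m] this]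
    have E: "(\<lambda>n. csch_primitive m (of_nat n * \<phi>) +
        (\<Sum>k=1..m+1. ?b k / (of_nat (2 * k - 1) * (of_nat n * \<phi>) ^ (2 * k - 1)))) \<longlonglongrightarrow> I" (is "?E \<longlonglongrightarrow> I")
      by (simp add: I_def del: sum.cl_ivl_Suc)
    hence "(\<lambda>n. 2 * ?E n) \<longlonglongrightarrow> 2 * I" by (rule tendsto_mult_left)
    thus ?thesis
    proof (rule Lim_transform_eventually)
      show "\<forall>\<^sub>F n in sequentially. 2 * ?E n = A 0 (of_nat n * \<phi>) - A 0 (- (of_nat n * \<phi>))"
        using eventually_gt_at_top[of 0]
      proof eventually_elim
        case (elim n)
        have nz: "of_nat n * \<phi> \<noteq> 0" using elim \<phi> by simp
        have X: "of_nat n * \<phi> \<in> slit_domain" "- (of_nat n * \<phi>) \<in> slit_domain"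
          using ray[OF \<phi>(1), of "real n"] ray[OF \<phi>(1), of "- real n"] by (simp_all add: X_slit)
        have "F (- (of_nat n * \<phi>)) = - ?E n"
          using nz unfolding F_eq[OF X(2), unfolded neg_equal_0_iff_equal, OF nz] csch_primitive_odd minus_add_distrib sum_negf[symmetric]
        proof (intro arg_cong2[where f = "(+)"] refl sum.cong)
          fix k assume "k \<in> {1..m+1}"
          hence "odd (2 * k - 1)" by simp
          hence "(- (of_nat n * \<phi>)) ^ (2 * k - 1) = - ((of_nat n * \<phi>) ^ (2 * k - 1))"
            by (rule power_minus_odd)
          thus "?b k / (of_nat (2 * k - 1) * (- (of_nat n * \<phi>)) ^ (2 * k - 1))
              = - (?b k / (of_nat (2 * k - 1) * (of_nat n * \<phi>) ^ (2 * k - 1)))"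
            by (simp only: mult_minus_right divide_minus_right)
        qed
        thus ?case using F_eq[OF X(1) nz] by (simp add: A_def)
      qed
    qed
  qed
  obtain K where K: "\<And>\<phi>. \<phi> \<in> \<Phi> \<Longrightarrow> 0 < norm \<phi> \<Longrightarrow> norm \<phi> \<le> 1 \<Longrightarrow>
      norm (\<phi> * two_sided_sum (A 1) \<phi> - 2 * I) * norm \<phi> \<le> K * norm \<phi> ^ R"
    using two_sided_sum_approximates_integral[where A = A and X = X and C = C and \<Phi> = \<Phi> and L = "2 * I" and R = R, OF deriv C ray lim]
    by blast
  have A1: "A 1 = ?f" by (simp add: A_def)
  show ?thesis
  proof (intro exI[of _ K] allI impI)
    fix \<phi> :: complex assume \<phi>': "\<epsilon> * norm \<phi> \<le> Re \<phi>" "0 < norm \<phi>" "norm \<phi> \<le> 1"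
    hence \<phi>: "\<phi> \<in> \<Phi>" by (simp add: \<Phi>_def)
    have "norm (A 1 (of_real t * \<phi>)) \<le> C 0 / (1 + (norm (of_real t * \<phi>))\<^sup>2)" for t :: real
      using C[OF ray[OF \<phi>], of 0] by simp
    hence "summable (\<lambda>n. ?f (of_nat n * \<phi>) + ?f (- (of_nat (Suc n) * \<phi>)))"
      unfolding A1 by (rule two_sided_sum_bound(1)) (use \<phi>' in auto)
    hence "S_fun m \<phi> = poly (calB m) \<phi> + \<phi> ^ (2 * m + 2) * two_sided_sum ?f \<phi> / 2"
      using pos[OF \<phi>] \<phi>' by (intro S_fun_two_sided_sum) auto
    hence "S_fun m \<phi> - poly (right_expansion m) \<phi> = \<phi> ^ (2 * m + 1) * (\<phi> * two_sided_sum (A 1) \<phi> - 2 * I) / 2"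
      unfolding A1 by (simp add: poly_monom I_def field_simps)
    \<comment> \<open>One of the \<open>2 * m + 1\<close> powers supplies the factor
      \<open>norm \<phi>\<close> that the bound with \<open>K\<close> requires; the others are at
      most 1.\<close>
    hence "norm (S_fun m \<phi> - poly (right_expansion m) \<phi>)
        = norm \<phi> ^ (2 * m) * (norm (\<phi> * two_sided_sum (A 1) \<phi> - 2 * I) * norm \<phi>) / 2"
      by (simp only:) (simp add: norm_mult norm_power norm_divide)
    also have "\<dots> \<le> 1 * (norm (\<phi> * two_sided_sum (A 1) \<phi> - 2 * I) * norm \<phi>) / 1"
      using \<phi>' by (intro frac_le mult_right_mono power_le_one) auto
    also have "\<dots> \<le> K * norm \<phi> ^ R" using K[OF \<phi>] \<phi>' by simp
    finally show "norm (S_fun m \<phi> - poly (right_expansion m) \<phi>) \<le> K * norm \<phi> ^ R" .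
  qed
qed

section \<open>Asymptotic series and the distillate\<close>

lemma poly_minus_partial_sum_bound:
  fixes P :: "complex poly"
  assumes "norm z \<le> 1"
  shows "norm (poly P z - (\<Sum>i\<le>k. coeff P i * z ^ i)) \<le> (\<Sum>i\<le>degree P. norm (coeff P i)) * norm z ^ Suc k"
proof -
  have "poly P z = (\<Sum>i\<le>max k (degree P). coeff P i * z ^ i)"
    unfolding poly_altdef by (rule sum.mono_neutral_left) (auto simp: coeff_eq_0)
  also have "{..max k (degree P)} = {..k} \<union> {k<..degree P}" by auto
  also have "(\<Sum>i\<in>\<dots>. coeff P i * z ^ i) = (\<Sum>i\<le>k. coeff P i * z ^ i) + (\<Sum>i\<in>{k<..degree P}. coeff P i * z ^ i)"
    by (rule sum.union_disjoint) auto
  finally have "norm (poly P z - (\<Sum>i\<le>k. coeff P i * z ^ i)) = norm (\<Sum>i\<in>{k<..degree P}. coeff P i * z ^ i)"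
    by simp
  also have "\<dots> \<le> (\<Sum>i\<in>{k<..degree P}. norm (coeff P i) * norm z ^ Suc k)"
  proof (rule sum_norm_le)
    fix i assume "i \<in> {k<..degree P}"
    hence "norm z ^ i \<le> norm z ^ Suc k" using assms by (intro power_decreasing) auto
    thus "norm (coeff P i * z ^ i) \<le> norm (coeff P i) * norm z ^ Suc k"
      by (simp add: norm_mult norm_power mult_left_mono)
  qed
  also have "\<dots> \<le> (\<Sum>i\<le>degree P. norm (coeff P i) * norm z ^ Suc k)"
    by (rule sum_mono2) auto
  finally show ?thesis by (simp only: sum_distrib_right)
qed

lemma sum_poly_series_int: "(\<Sum>n=0..int k. poly_series P n * z powi n) = (\<Sum>i\<le>k. coeff P i * z ^ i)"
proof -
  have "(\<Sum>n=0..int k. poly_series P n * z powi n) = (\<Sum>n\<in>int ` {..k}. poly_series P n * z powi n)"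
    by (rule sum.cong) (auto simp: image_int_atLeastAtMost atMost_atLeast0)
  thus ?thesis by (simp add: sum.reindex poly_series_def)
qed

text \<open>A bound with exponent N + 1 gives the little-o condition at N. Truncations below the
  degree of \<open>P\<close> are covered too, since the omitted monomials have exponent at least N +
  1.\<close>

lemma has_asymp_series_polyI:
  assumes isl: "\<exists>\<epsilon>>0. 0 islimpt approach_region A 0 \<epsilon>"
    and rem: "\<And>\<epsilon> R. \<epsilon> > 0 \<Longrightarrow> \<exists>K. \<forall>\<phi>\<in>approach_region A 0 \<epsilon>. 0 < norm \<phi> \<longrightarrow> norm \<phi> \<le> 1 \<longrightarrow>
               norm (f \<phi> - poly P \<phi>) \<le> K * norm \<phi> ^ R"
  shows "has_asymp_series f 0 A (poly_series P)"
  unfolding has_asymp_series_def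
proof (intro conjI isl exI[of _ 0] allI impI)
  fix n :: int assume "n < 0" thus "poly_series P n = 0" by (simp add: poly_series_def)
next
  fix \<epsilon> :: real and N :: int assume \<epsilon>: "\<epsilon> > 0"
  define M where "M = (\<Sum>i\<le>degree P. norm (coeff P i))"
  have M: "M \<ge> 0" by (simp add: M_def sum_nonneg)
  let ?S = "\<lambda>\<phi>. \<Sum>n=0..N. poly_series P n * (\<phi> - 0) powi n"
  obtain C where C: "\<And>\<phi>. \<phi> \<in> approach_region A 0 \<epsilon> \<Longrightarrow> 0 < norm \<phi> \<Longrightarrow> norm \<phi> \<le> 1 \<Longrightarrow>
      norm (f \<phi> - ?S \<phi>) \<le> C * (norm \<phi> * norm \<phi> powi N)"
  \<comment> \<open>For negative \<open>N\<close> the partial sum is empty; boundedness of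
    \<open>f\<close> suffices, because \<open>norm \<phi> * norm \<phi> powi N\<close> is at least
    1.\<close>
  proof (cases "N < 0")
    case True
    obtain K where K: "\<And>\<phi>. \<phi> \<in> approach_region A 0 \<epsilon> \<Longrightarrow> 0 < norm \<phi> \<Longrightarrow> norm \<phi> \<le> 1 \<Longrightarrow>
      norm (f \<phi> - poly P \<phi>) \<le> K * norm \<phi> ^ 0" using rem[OF \<epsilon>, of 0] by blast
    show ?thesis
    proof (rule that)
      fix \<phi> assume \<phi>: "\<phi> \<in> approach_region A 0 \<epsilon>" "0 < norm \<phi>" "norm \<phi> \<le> 1"
      have "norm (poly P \<phi>) \<le> (\<Sum>i\<le>degree P. norm (coeff P i))"
        unfolding poly_altdef
      proof (rule sum_norm_le)
        fix i show "norm (coeff P i * \<phi> ^ i) \<le> norm (coeff P i)"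
          using \<phi> by (simp add: norm_mult norm_power mult_left_le power_le_one)
      qed
      moreover have "norm (f \<phi> - poly P \<phi>) \<le> K" using K[OF \<phi>] by simp
      moreover have "norm (f \<phi>) \<le> norm (f \<phi> - poly P \<phi>) + norm (poly P \<phi>)"
        using norm_triangle_sub[of "f \<phi>" "poly P \<phi>"] by simp
      ultimately have f: "norm (f \<phi>) \<le> \<bar>K\<bar> + M" by (simp add: M_def)
      obtain j where j: "N = - int (Suc j)" using True by (metis negD)
      have "norm \<phi> * norm \<phi> powi N = 1 / norm \<phi> ^ j"
        using \<phi> by (simp add: j power_int_minus field_simps del: of_nat_Suc)
      moreover have "1 \<le> 1 / norm \<phi> ^ j"
        using \<phi> by (simp add: power_le_one)
      ultimately have "(\<bar>K\<bar> + M) * 1 \<le> (\<bar>K\<bar> + M) * (norm \<phi> * norm \<phi> powi N)"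
        using M by (intro mult_left_mono) auto
      thus "norm (f \<phi> - ?S \<phi>) \<le> (\<bar>K\<bar> + M) * (norm \<phi> * norm \<phi> powi N)" using f True by simp
    qed
  next
    case False
    then obtain k where k: "N = int k" by (metis nonneg_int_cases linorder_not_less)
    obtain K where K: "\<And>\<phi>. \<phi> \<in> approach_region A 0 \<epsilon> \<Longrightarrow> 0 < norm \<phi> \<Longrightarrow> norm \<phi> \<le> 1 \<Longrightarrow>
      norm (f \<phi> - poly P \<phi>) \<le> K * norm \<phi> ^ Suc k" using rem[OF \<epsilon>, of "Suc k"] by blast
    show ?thesis
    proof (rule that)
      fix \<phi> assume \<phi>: "\<phi> \<in> approach_region A 0 \<epsilon>" "0 < norm \<phi>" "norm \<phi> \<le> 1"
      have "f \<phi> - ?S \<phi> = (f \<phi> - poly P \<phi>) + (poly P \<phi> - (\<Sum>i\<le>k. coeff P i * \<phi> ^ i))"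
        by (simp add: k sum_poly_series_int)
      also have "norm \<dots> \<le> K * norm \<phi> ^ Suc k + M * norm \<phi> ^ Suc k"
        unfolding M_def by (intro norm_triangle_mono K[OF \<phi>] poly_minus_partial_sum_bound \<phi>)
      finally show "norm (f \<phi> - ?S \<phi>) \<le> (K + M) * (norm \<phi> * norm \<phi> powi N)"
        by (simp add: k distrib_right)
    qed
  qed
  show "(\<lambda>\<phi>. f \<phi> - ?S \<phi>) \<in> o[at 0 within approach_region A 0 \<epsilon>](\<lambda>\<phi>. (\<phi> - 0) powi N)"
  proof (rule landau_o.smallI)
    fix c :: real assume c: "c > 0"
    \<comment> \<open>Ensures \<open>C * norm \<phi> \<le> c\<close>; adding 1 keeps the denominator
      positive.\<close>
    define d where "d = min 1 (c / (\<bar>C\<bar> + 1))"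
    have d: "d > 0" using c by (simp add: d_def)
    have "norm (f \<phi> - ?S \<phi>) \<le> c * norm ((\<phi> - 0) powi N)"
      if \<phi>: "\<phi> \<in> approach_region A 0 \<epsilon>" "\<phi> \<noteq> 0" "dist \<phi> 0 < d" for \<phi>
    proof -
      have n: "0 < norm \<phi>" "norm \<phi> \<le> 1" "norm \<phi> \<le> c / (\<bar>C\<bar> + 1)" using \<phi> by (auto simp: d_def)
      have "C * norm \<phi> \<le> (\<bar>C\<bar> + 1) * (c / (\<bar>C\<bar> + 1))" using n by (intro mult_mono) auto
      hence "C * norm \<phi> \<le> c" by simp
      hence "C * norm \<phi> * norm \<phi> powi N \<le> c * norm \<phi> powi N" by (intro mult_right_mono) auto
      thus ?thesis using C[OF \<phi>(1) n(1,2)] by (simp add: norm_power_int mult_ac)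
    qed
    thus "\<forall>\<^sub>F \<phi> in at 0 within approach_region A 0 \<epsilon>. norm (f \<phi> - ?S \<phi>) \<le> c * norm ((\<phi> - 0) powi N)"
      unfolding eventually_at using d by blast
  qed
qed

lemma approach_region_left:
  assumes "\<epsilon> > 0"
  shows "approach_region left_half_plane 0 \<epsilon> = {\<phi>. \<epsilon> * norm \<phi> \<le> - Re \<phi>}"
proof -
  have "ball \<phi> r \<subseteq> left_half_plane \<longleftrightarrow> ball (- \<phi>) r \<subseteq> right_half_plane" for \<phi> :: complex and r
  proof -
    have "w \<in> ball (- \<phi>) r \<longleftrightarrow> - w \<in> ball \<phi> r" for w
      using norm_minus_cancel[of "\<phi> + w"] by (simp add: dist_norm)
    thus ?thesis unfolding subset_iff mem_Collect_eq
      by (metis minus_minus neg_less_0_iff_less uminus_complex.sel(1))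
  qed
  hence "approach_region left_half_plane 0 \<epsilon> = {\<phi>. - \<phi> \<in> approach_region right_half_plane 0 \<epsilon>}"
    by (simp add: approach_region_def)
  thus ?thesis unfolding approach_region_right[OF assms] by simp
qed

lemma S_fun_right_asymp: "has_asymp_series (S_fun m) 0 right_half_plane (poly_series (right_expansion m))"
proof (rule has_asymp_series_polyI)
  \<comment> \<open>For \<open>\<epsilon> = 1\<close> the region is the ray of nonnegative
    reals.\<close>
  have "0 islimpt approach_region right_half_plane 0 1"
    unfolding islimpt_approachable approach_region_right[OF zero_less_one]
  proof (intro allI impI)
    fix e :: real assume "e > 0"
    thus "\<exists>z\<in>{z. 1 * norm z \<le> Re z}. z \<noteq> 0 \<and> dist z 0 < e"
      by (intro bexI[of _ "of_real (e / 2)"]) auto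
  qed
  thus "\<exists>\<epsilon>>0. 0 islimpt approach_region right_half_plane 0 \<epsilon>" using zero_less_one by blast
next
  fix \<epsilon> :: real and R :: nat assume \<epsilon>: "\<epsilon> > 0"
  \<comment> \<open>The remainder estimate needs \<open>\<epsilon> \<le> 1\<close>; a larger
    parameter only shrinks the region.\<close>
  then obtain K where K: "\<And>\<phi>. min \<epsilon> 1 * norm \<phi> \<le> Re \<phi> \<Longrightarrow> 0 < norm \<phi> \<Longrightarrow> norm \<phi> \<le> 1 \<Longrightarrow>
      norm (S_fun m \<phi> - poly (right_expansion m) \<phi>) \<le> K * norm \<phi> ^ R"
    using S_fun_right_remainder[of "min \<epsilon> 1" m R] by auto
  show "\<exists>K. \<forall>\<phi>\<in>approach_region right_half_plane 0 \<epsilon>. 0 < norm \<phi> \<longrightarrow> norm \<phi> \<le> 1 \<longrightarrow>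
      norm (S_fun m \<phi> - poly (right_expansion m) \<phi>) \<le> K * norm \<phi> ^ R"
  proof (intro exI[of _ K] ballI impI K)
    fix \<phi> :: complex assume "\<phi> \<in> approach_region right_half_plane 0 \<epsilon>"
    hence "\<epsilon> * norm \<phi> \<le> Re \<phi>" unfolding approach_region_right[OF \<epsilon>] by simp
    moreover have "min \<epsilon> 1 * norm \<phi> \<le> \<epsilon> * norm \<phi>" by (intro mult_right_mono) auto
    ultimately show "min \<epsilon> 1 * norm \<phi> \<le> Re \<phi>" by linarith
  qed
qed

lemma poly_right_expansion_minus: "poly (right_expansion m) (- \<phi>) = poly (left_expansion m) \<phi>"
  by (simp add: poly_calB_even poly_monom)

text \<open>Substituting \<open>- \<phi>\<close> in the right-hand estimate: the series and
  \<open>calB m\<close> are even, so only the odd monomial changes sign.\<close>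

lemma S_fun_left_asymp: "has_asymp_series (S_fun m) 0 left_half_plane (poly_series (left_expansion m))"
proof (rule has_asymp_series_polyI)
  have "0 islimpt approach_region left_half_plane 0 1"
    unfolding islimpt_approachable approach_region_left[OF zero_less_one]
  proof (intro allI impI)
    fix e :: real assume "e > 0"
    thus "\<exists>z\<in>{z. 1 * norm z \<le> - Re z}. z \<noteq> 0 \<and> dist z 0 < e"
      by (intro bexI[of _ "- of_real (e / 2)"]) auto
  qed
  thus "\<exists>\<epsilon>>0. 0 islimpt approach_region left_half_plane 0 \<epsilon>" using zero_less_one by blast
next
  fix \<epsilon> :: real and R :: nat assume \<epsilon>: "\<epsilon> > 0"
  then obtain K where K: "\<And>\<phi>. min \<epsilon> 1 * norm \<phi> \<le> Re \<phi> \<Longrightarrow> 0 < norm \<phi> \<Longrightarrow> norm \<phi> \<le> 1 \<Longrightarrow>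
      norm (S_fun m \<phi> - poly (right_expansion m) \<phi>) \<le> K * norm \<phi> ^ R"
    using S_fun_right_remainder[of "min \<epsilon> 1" m R] by auto
  show "\<exists>K. \<forall>\<phi>\<in>approach_region left_half_plane 0 \<epsilon>. 0 < norm \<phi> \<longrightarrow> norm \<phi> \<le> 1 \<longrightarrow>
      norm (S_fun m \<phi> - poly (left_expansion m) \<phi>) \<le> K * norm \<phi> ^ R"
  proof (intro exI[of _ K] ballI impI)
    fix \<phi> :: complex assume \<phi>: "\<phi> \<in> approach_region left_half_plane 0 \<epsilon>" "0 < norm \<phi>" "norm \<phi> \<le> 1"
    have "\<epsilon> * norm \<phi> \<le> - Re \<phi>" using \<phi>(1) unfolding approach_region_left[OF \<epsilon>] by simp
    moreover have "min \<epsilon> 1 * norm \<phi> \<le> \<epsilon> * norm \<phi>" by (intro mult_right_mono) auto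
    ultimately have "min \<epsilon> 1 * norm (- \<phi>) \<le> Re (- \<phi>)"
      unfolding norm_minus_cancel uminus_complex.sel by linarith
    from K[OF this] \<phi> show "norm (S_fun m \<phi> - poly (left_expansion m) \<phi>) \<le> K * norm \<phi> ^ R"
      by (simp only: S_fun_even poly_right_expansion_minus norm_minus_cancel simp_thms)
  qed
qed

text \<open>The two expansions differ only at index \<open>2 * m + 1\<close>, and they do differ
  there because \<open>odd_coeff m\<close> is nonzero. The common coefficient is therefore 0, which
  is also the coefficient of the even polynomial \<open>calB m\<close>.\<close>

lemma S_fun_analytic_distillate:
  "has_analytic_distillate (S_fun m) 0 {\<phi>. Re \<phi> \<noteq> 0} {right_half_plane, left_half_plane} (poly (calB m))"
proof -
  define a where "a = (\<lambda>A::complex set. poly_series (if A = right_half_plane then right_expansion m else left_expansion m))"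
  let ?D = "{right_half_plane, left_half_plane}"
  have "1 \<in> right_half_plane" "(1::complex) \<notin> left_half_plane" by simp_all
  hence neq: "left_half_plane \<noteq> right_half_plane" by blast
  have odd0: "coeff (calB m) (2 * m + 1) = 0"
    unfolding calB_def coeff_sum by (rule sum.neutral) (auto, presburger)
  have oc: "odd_coeff m \<noteq> 0" by (simp add: odd_coeff_def del: fact_Suc)
  have some: "(SOME A. A \<in> ?D) \<in> ?D" by (rule someI[of _ right_half_plane]) simp
  have c: "common_coeff ?D a (int n) = coeff (calB m) n" for n
  proof (cases "n = 2 * m + 1")
    case True
    have "a right_half_plane (int n) \<noteq> a left_half_plane (int n)"
      using neq oc odd0 by (simp add: a_def poly_series_def True neq)
    thus ?thesis using odd0 True unfolding common_coeff_def by auto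
  next
    case False
    hence "a A (int n) = coeff (calB m) n" for A by (simp add: a_def poly_series_def)
    thus ?thesis unfolding common_coeff_def by simp
  qed
  have sums: "(\<lambda>n. coeff (calB m) n * z ^ n) sums poly (calB m) z" for z
    unfolding poly_altdef by (rule sums_finite) (auto simp: coeff_eq_0)
  have "\<Union>?D = {\<phi>. Re \<phi> \<noteq> 0}" by auto
  moreover have "(0::complex) \<in> closure {\<phi>. Re \<phi> \<noteq> 0}"
    unfolding closure_approachable
  proof (intro allI impI)
    fix e :: real assume "e > 0"
    thus "\<exists>z\<in>{z. Re z \<noteq> 0}. dist z 0 < e"
      by (intro bexI[of _ "of_real (e / 2)"]) auto
  qed
  moreover have "open {\<phi>::complex. Re \<phi> \<noteq> 0}" by (intro open_Collect_neq continuous_intros)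
  moreover have "\<forall>A\<in>?D. has_asymp_series (S_fun m) 0 A (a A)"
    using S_fun_right_asymp[of m] S_fun_left_asymp[of m] neq by (simp add: a_def)
  moreover have "conv_radius (\<lambda>n. coeff (calB m) n) = \<infinity>"
    using fps_conv_radius_fps_of_poly[of "calB m"] by (simp add: fps_conv_radius_def)
  ultimately show ?thesis
    unfolding has_analytic_distillate_def using sums by (auto simp: c Let_def intro!: exI[of _ a])
qed

theorem mainTheorem7:
  fixes m :: nat
  shows "has_asymp_series (S_fun m) 0 right_half_plane
           (poly_series (calB m + monom ((-1) ^ (m + 1) * odd_coeff m) (2 * m + 1)))
         \<and> has_asymp_series (S_fun m) 0 left_half_plane
           (poly_series (calB m - monom ((-1) ^ (m + 1) * odd_coeff m) (2 * m + 1)))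
         \<and> has_analytic_distillate (S_fun m) 0 {\<phi>. Re \<phi> \<noteq> 0}
           {right_half_plane, left_half_plane} (poly (calB m))"
  using S_fun_right_asymp S_fun_left_asymp S_fun_analytic_distillate by blast

end
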